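(* Let $A$ be a self-adjoint operator on a Hilbert space $\mathcal{H}$ and let $B$ be a bounded self-adjoint operator on $\mathcal{H}$ with $b^-:=\min\sigma(B)<b^+:=\max\sigma(B)$. If $A$ is unbounded from above and/or below, then \[ \sigma(A+iB)\subset\mathcal{X}_A . \] If $A$ is bounded with $a^-:=\min\sigma(A)<a^+:=\max\sigma(A)$, then \[ \sigma(A+iB)\subset\mathcal{X}_A\cap\mathcal{Y}_B . \]
   Context: For real numbers $\alpha<\beta$ and $\gamma<\delta$ the region $\mathcal{U}_{\alpha,\beta}^{\gamma,\delta}\subset\mathbb{C}$ is defined as follows. (1) If $\beta-\alpha\le\delta-\gamma$, put for $x\in[\alpha,\beta]$ \[ h_\pm(x)=\frac{\gamma+\delta}{2}\pm\sqrt{\Big(\frac{\delta-\gamma}{2}\Big)^2+(x-\alpha)(x-\beta)}, \] and \[ \mathcal{U}_{\alpha,\beta}^{\gamma,\delta}=\{z\in\mathbb{C}:\alpha<\mathrm{Re}\,z<\beta,\text{ and either }\gamma\le\mathrm{Im}\,z<h_-(\mathrm{Re}\,z)\text{ or }h_+(\mathrm{Re}\,z)<\mathrm{Im}\,z\le\delta\}. \] (2) If $\beta-\alpha>\delta-\gamma$, put for $y\in[\gamma,\delta]$ \[ k_\pm(y)=\frac{\alpha+\beta}{2}\pm\sqrt{\Big(\frac{\beta-\alpha}{2}\Big)^2+(y-\gamma)(y-\delta)}, \] and \[ \mathcal{U}_{\alpha,\beta}^{\gamma,\delta}=\{z\in\mathbb{C}:\gamma\le\mathrm{Im}\,z\le\delta,\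 k_-(\mathrm{Im}\,z)<\mathrm{Re}\,z<k_+(\mathrm{Im}\,z)\}. \] Let $W(\cdot)$ denote the numerical range, $\sigma(\cdot)$ the spectrum and $\rho(\cdot)$ the resolvent set. In the unions below $a<b$. Define \[ \mathcal{U}_A=\bigcup_{a,b\in W(A),\ (a,b)\subset\rho(A)}\mathcal{U}_{a,b}^{b^-,b^+},\qquad \mathcal{X}_A=\{z\in\mathbb{C}:\mathrm{Re}\,z\in\overline{W(A)},\ b^-\le\mathrm{Im}\,z\le b^+\}\setminus\mathcal{U}_A, \] and, when $A$ is bounded, \[ \hat{\mathcal{V}}_B=\bigcup_{a,b\in W(B),\ (a,b)\subset\rho(B)}\mathcal{U}_{a,b}^{a^-,a^+},\qquad \mathcal{V}_B=\{z\in\mathbb{C}:\mathrm{Im}\,z+i\,\mathrm{Re}\,z\in\hat{\mathcal{V}}_B\}, \] \[ \mathcal{Y}_B=\{z\in\mathbb{C}:\mathrm{Im}\,z\in\overline{W(B)},\ a^-\le\mathrm{Re}\,z\le a^+\}\setminus\mathcal{V}_B . \] *)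

theory Defs
  imports "HOL-Analysis.Analysis"
begin

section \<open>Complex Hilbert spaces\<close>

class complex_vector = real_vector +
  fixes scaleC :: "complex \<Rightarrow> 'a \<Rightarrow> 'a"  (infixr \<open>*\<^sub>C\<close> 75)
  assumes scaleC_add_right: "c *\<^sub>C (x + y) = c *\<^sub>C x + c *\<^sub>C y"
    and scaleC_add_left: "(c + d) *\<^sub>C x = c *\<^sub>C x + d *\<^sub>C x"
    and scaleC_scaleC: "c *\<^sub>C (d *\<^sub>C x) = (c * d) *\<^sub>C x"
    and scaleC_of_real: "complex_of_real r *\<^sub>C x = r *\<^sub>R x"

lemma scaleC_one: "1 *\<^sub>C x = (x :: 'a::complex_vector)"
  using scaleC_of_real[of 1 x] by simp

interpretation complex_vector: vector_space "scaleC :: complex \<Rightarrow> 'a \<Rightarrow> 'a::complex_vector"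
  by unfold_locales
    (simp_all add: scaleC_add_right scaleC_add_left scaleC_scaleC scaleC_one)

text \<open>The inner product is linear in its first argument; its real part is the library's
  real inner product, which induces the norm and the topology.\<close>

class complex_hilbert_space = complex_vector + real_inner + complete_space +
  fixes cinner :: "'a \<Rightarrow> 'a \<Rightarrow> complex"
  assumes cinner_commute: "cinner x y = cnj (cinner y x)"
    and cinner_add_left: "cinner (x + y) z = cinner x z + cinner y z"
    and cinner_scaleC_left: "cinner (c *\<^sub>C x) y = c * cinner x y"
    and Re_cinner: "Re (cinner x y) = inner x y"

instantiation complex :: complex_hilbert_space
begin
definition scaleC_complex :: "complex \<Rightarrow> complex \<Rightarrow> complex"
  where "scaleC_complex c x = c * x"
definition cinner_complex :: "complex \<Rightarrow> complex \<Rightarrow> complex"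
  where "cinner_complex x y = x * cnj y"
instance
  by standard (simp_all add: scaleC_complex_def cinner_complex_def algebra_simps
      scaleR_conv_of_real inner_complex_def)
end

instantiation prod :: (complex_hilbert_space, complex_hilbert_space) complex_hilbert_space
begin
definition scaleC_prod :: "complex \<Rightarrow> 'a \<times> 'b \<Rightarrow> 'a \<times> 'b"
  where "scaleC_prod c x = (c *\<^sub>C fst x, c *\<^sub>C snd x)"
definition cinner_prod :: "'a \<times> 'b \<Rightarrow> 'a \<times> 'b \<Rightarrow> complex"
  where "cinner_prod x y = cinner (fst x) (fst y) + cinner (snd x) (snd y)"
instance
proof
  fix x y :: "'a \<times> 'b"
  show "cinner x y = cnj (cinner y x)"
    unfolding cinner_prod_def complex_cnj_add
    by (metis cinner_commute)
qed (simp_all add: scaleC_prod_def cinner_prod_def scaleC_add_right scaleC_add_left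
      scaleC_scaleC scaleC_of_real scaleR_prod_def cinner_add_left cinner_scaleC_left
      Re_cinner inner_prod_def algebra_simps)
end


section \<open>Operators with a domain\<close>

text \<open>A (possibly unbounded) operator is given by its domain \<open>D\<close> and a function \<open>T\<close>
  whose values outside \<open>D\<close> are irrelevant.\<close>

definition linear_operator :: "'a::complex_vector set \<Rightarrow> ('a \<Rightarrow> 'a) \<Rightarrow> bool"
  where "linear_operator D T \<longleftrightarrow> complex_vector.subspace D \<and>
    (\<forall>x\<in>D. \<forall>y\<in>D. T (x + y) = T x + T y) \<and> (\<forall>c. \<forall>x\<in>D. T (c *\<^sub>C x) = c *\<^sub>C T x)"

definition bounded_operator :: "'a::complex_hilbert_space set \<Rightarrow> ('a \<Rightarrow> 'a) \<Rightarrow> bool"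
  where "bounded_operator D T \<longleftrightarrow> (\<exists>K. \<forall>x\<in>D. norm (T x) \<le> K * norm x)"

definition adjoint_graph :: "'a::complex_hilbert_space set \<Rightarrow> ('a \<Rightarrow> 'a) \<Rightarrow> ('a \<times> 'a) set"
  where "adjoint_graph D T = {(y, w). \<forall>x\<in>D. cinner (T x) y = cinner x w}"

definition self_adjoint :: "'a::complex_hilbert_space set \<Rightarrow> ('a \<Rightarrow> 'a) \<Rightarrow> bool"
  where "self_adjoint D T \<longleftrightarrow> linear_operator D T \<and> closure D = UNIV \<and>
    adjoint_graph D T = {(x, T x) | x. x \<in> D}"

definition resolvent_set :: "'a::complex_hilbert_space set \<Rightarrow> ('a \<Rightarrow> 'a) \<Rightarrow> complex set"
  where "resolvent_set D T = {z. bij_betw (\<lambda>x. T x - z *\<^sub>C x) D UNIV \<and>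
    bounded_linear (inv_into D (\<lambda>x. T x - z *\<^sub>C x))}"

definition spectrum :: "'a::complex_hilbert_space set \<Rightarrow> ('a \<Rightarrow> 'a) \<Rightarrow> complex set"
  where "spectrum D T = - resolvent_set D T"

definition numerical_range :: "'a::complex_hilbert_space set \<Rightarrow> ('a \<Rightarrow> 'a) \<Rightarrow> complex set"
  where "numerical_range D T = {cinner (T x) x | x. x \<in> D \<and> norm x = 1}"

text \<open>Minimum and maximum of the spectrum, for operators whose spectrum is real.\<close>

definition min_spectrum :: "'a::complex_hilbert_space set \<Rightarrow> ('a \<Rightarrow> 'a) \<Rightarrow> real"
  where "min_spectrum D T = (LEAST t. complex_of_real t \<in> spectrum D T)"

definition max_spectrum :: "'a::complex_hilbert_space set \<Rightarrow> ('a \<Rightarrow> 'a) \<Rightarrow> real"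
  where "max_spectrum D T = (GREATEST t. complex_of_real t \<in> spectrum D T)"

text \<open>The numerical range of a self-adjoint operator is real, so passing to real parts only
  changes the type.\<close>

definition bounded_from_above :: "'a::complex_hilbert_space set \<Rightarrow> ('a \<Rightarrow> 'a) \<Rightarrow> bool"
  where "bounded_from_above D T \<longleftrightarrow> bdd_above (Re ` numerical_range D T)"

definition bounded_from_below :: "'a::complex_hilbert_space set \<Rightarrow> ('a \<Rightarrow> 'a) \<Rightarrow> bool"
  where "bounded_from_below D T \<longleftrightarrow> bdd_below (Re ` numerical_range D T)"


section \<open>The enclosing regions\<close>

definition h_minus :: "real \<Rightarrow> real \<Rightarrow> real \<Rightarrow> real \<Rightarrow> real \<Rightarrow> real"
  where "h_minus \<alpha> \<beta> \<gamma> \<delta> x =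
    (\<gamma> + \<delta>) / 2 - sqrt (((\<delta> - \<gamma>) / 2)\<^sup>2 + (x - \<alpha>) * (x - \<beta>))"

definition h_plus :: "real \<Rightarrow> real \<Rightarrow> real \<Rightarrow> real \<Rightarrow> real \<Rightarrow> real"
  where "h_plus \<alpha> \<beta> \<gamma> \<delta> x =
    (\<gamma> + \<delta>) / 2 + sqrt (((\<delta> - \<gamma>) / 2)\<^sup>2 + (x - \<alpha>) * (x - \<beta>))"

definition k_minus :: "real \<Rightarrow> real \<Rightarrow> real \<Rightarrow> real \<Rightarrow> real \<Rightarrow> real"
  where "k_minus \<alpha> \<beta> \<gamma> \<delta> y =
    (\<alpha> + \<beta>) / 2 - sqrt (((\<beta> - \<alpha>) / 2)\<^sup>2 + (y - \<gamma>) * (y - \<delta>))"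

definition k_plus :: "real \<Rightarrow> real \<Rightarrow> real \<Rightarrow> real \<Rightarrow> real \<Rightarrow> real"
  where "k_plus \<alpha> \<beta> \<gamma> \<delta> y =
    (\<alpha> + \<beta>) / 2 + sqrt (((\<beta> - \<alpha>) / 2)\<^sup>2 + (y - \<gamma>) * (y - \<delta>))"

definition region_U :: "real \<Rightarrow> real \<Rightarrow> real \<Rightarrow> real \<Rightarrow> complex set"
  where "region_U \<alpha> \<beta> \<gamma> \<delta> =
    (if \<beta> - \<alpha> \<le> \<delta> - \<gamma>
     then {z. \<alpha> < Re z \<and> Re z < \<beta> \<and>
            (\<gamma> \<le> Im z \<and> Im z < h_minus \<alpha> \<beta> \<gamma> \<delta> (Re z) \<or>
             h_plus \<alpha> \<beta> \<gamma> \<delta> (Re z) < Im z \<and> Im z \<le> \<delta>)}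
     else {z. \<gamma> \<le> Im z \<and> Im z \<le> \<delta> \<and>
            k_minus \<alpha> \<beta> \<gamma> \<delta> (Im z) < Re z \<and> Re z < k_plus \<alpha> \<beta> \<gamma> \<delta> (Im z)})"

text \<open>With \<open>c = b\<^sup>-\<close>, \<open>d = b\<^sup>+\<close> and \<open>T = A\<close> the following union is \<open>\<U>\<^sub>A\<close>; with
  \<open>c = a\<^sup>-\<close>, \<open>d = a\<^sup>+\<close> and \<open>T = B\<close> it is the hatted set from which \<open>\<V>\<^sub>B\<close> arises by
  exchanging real and imaginary parts.\<close>

definition union_U :: "'a::complex_hilbert_space set \<Rightarrow> ('a \<Rightarrow> 'a) \<Rightarrow> real \<Rightarrow> real \<Rightarrow> complex set"
  where "union_U D T c d = \<Union> {region_U a b c d | a b. a < b \<and>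
    complex_of_real a \<in> numerical_range D T \<and> complex_of_real b \<in> numerical_range D T \<and>
    complex_of_real ` {a<..<b} \<subseteq> resolvent_set D T}"

definition region_X :: "'a::complex_hilbert_space set \<Rightarrow> ('a \<Rightarrow> 'a) \<Rightarrow> real \<Rightarrow> real \<Rightarrow> complex set"
  where "region_X D A bmin bmax =
    {z. complex_of_real (Re z) \<in> closure (numerical_range D A) \<and> bmin \<le> Im z \<and> Im z \<le> bmax}
    - union_U D A bmin bmax"

definition region_V :: "'a::complex_hilbert_space set \<Rightarrow> ('a \<Rightarrow> 'a) \<Rightarrow> real \<Rightarrow> real \<Rightarrow> complex set"
  where "region_V D B amin amax =
    {z. complex_of_real (Im z) + \<i> * complex_of_real (Re z) \<in> union_U D B amin amax}"

definition region_Y :: "'a::complex_hilbert_space set \<Rightarrow> ('a \<Rightarrow> 'a) \<Rightarrow> real \<Rightarrow> real \<Rightarrow> complex set"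
  where "region_Y D B amin amax =
    {z. complex_of_real (Im z) \<in> closure (numerical_range D B) \<and> amin \<le> Re z \<and> Re z \<le> amax}
    - region_V D B amin amax"

end

theory Submission
  imports Defs
begin

text \<open>Put \<open>P = A - x\<close> and \<open>Q = B - y\<close>. As \<open>A\<close> and \<open>B\<close> are symmetric, a unit vector \<open>u\<close> with
  \<open>(P + \<i>Q) u = 0\<close> has \<open>\<langle>Pu, u\<rangle> = \<langle>Qu, u\<rangle> = 0\<close> and \<open>\<parallel>Pu\<parallel> = \<parallel>Qu\<parallel>\<close>. Since \<open>(a,b)\<close> lies in the resolvent set of
  \<open>A\<close>, \<open>A\<close> shifted by the midpoint of \<open>(a,b)\<close> is bounded below by \<open>(b - a)/2\<close>, hence
  \<open>\<parallel>Pu\<parallel>\<^sup>2 \<ge> (x - a)(b - x)\<close>; since \<open>c \<le> B \<le> d\<close>, likewise \<open>\<parallel>Qu\<parallel>\<^sup>2 \<le> (y - c)(d - y)\<close>. The region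
  \<open>\<U>\<close> is exactly where these bounds contradict each other. Quantitatively, \<open>P \<plusminus> \<i>Q\<close> are bounded
  below there, so that \<open>x + \<i>y\<close> belongs to the resolvent set of \<open>A + \<i>B\<close>. The second enclosure is
  the first one with the roles of \<open>A\<close> and \<open>B\<close> exchanged, because \<open>Q + \<i>P = \<i>(P - \<i>Q)\<close>.\<close>

section \<open>Orthogonal complements and symmetric operators in real inner product spaces\<close>

text \<open>For \<open>v\<close> outside \<open>M\<close> with nearest point \<open>m\<close> in
  \<open>M\<close>, the vector \<open>v - m\<close> is orthogonal to \<open>M\<close>. A minimizing
  sequence is Cauchy by the parallelogram law. Real orthogonality is the right notion here, since
  \<open>self_adjoint_maximal\<close> also works with the real inner product.\<close>

lemma closed_subspace_orthogonal_vector: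
  fixes M :: "'a::{real_inner, complete_space} set"
  assumes "closed M" and "subspace M" and "M \<noteq> UNIV"
  obtains y where "y \<noteq> 0" and "\<And>m. m \<in> M \<Longrightarrow> inner m y = 0"
proof -
  obtain v where v: "v \<notin> M" using assms(3) by blast
  have ne: "M \<noteq> {}" using subspace_0[OF assms(2)] by blast
  define d where "d = infdist v M"
  have d0: "d \<ge> 0" by (simp add: d_def infdist_nonneg)
  have d_le: "d \<le> norm (v - m)" if "m \<in> M" for m
    using infdist_le[OF that] by (simp add: d_def dist_norm)
  have "\<exists>m\<in>M. dist v m < d + inverse (real (Suc n))" for n
  proof (rule ccontr)
    assume "\<not> ?thesis"
    then have "d + inverse (real (Suc n)) \<le> infdist v M"
      unfolding infdist_notempty[OF ne] by (intro cINF_greatest[OF ne]) (auto simp: not_less)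
    then show False by (simp add: d_def)
  qed
  then obtain f where fM: "\<And>n. f n \<in> M"
    and fd: "\<And>n. dist v (f n) < d + inverse (real (Suc n))"
    by metis
  \<comment> \<open>\<open>g N\<close> is the parallelogram bound on squared distances from index
    \<open>N\<close> on: both points lie within \<open>d + 1/(N + 1)\<close> of \<open>v\<close>,
    and their midpoint is no closer than \<open>d\<close>.\<close>
  define g where "g n = 4 * ((d + inverse (real (Suc n)))\<^sup>2 - d\<^sup>2)" for n
  have "g \<longlonglongrightarrow> 4 * ((d + 0)\<^sup>2 - d\<^sup>2)"
    unfolding g_def by (intro tendsto_intros LIMSEQ_inverse_real_of_nat)
  then have g: "g \<longlonglongrightarrow> 0" by simp
  have par: "(norm (f j - f k))\<^sup>2 \<le> g N" if "j \<ge> N" "k \<ge> N" for j k N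
  proof -
    have mid: "(1/2) *\<^sub>R (f j + f k) \<in> M"
      using assms(2) fM by (simp add: subspace_add subspace_scale)
    have near: "(norm (v - f i))\<^sup>2 \<le> (d + inverse (real (Suc N)))\<^sup>2" if "i \<ge> N" for i
    proof -
      have "inverse (real (Suc i)) \<le> inverse (real (Suc N))"
        using that by (intro le_imp_inverse_le) auto
      with fd[of i] have "norm (v - f i) \<le> d + inverse (real (Suc N))"
        unfolding dist_norm by linarith
      then show ?thesis by (rule power_mono) simp
    qed
    have "(norm (f j - f k))\<^sup>2 = 2 * (norm (v - f j))\<^sup>2 + 2 * (norm (v - f k))\<^sup>2
        - 4 * (norm (v - (1/2) *\<^sub>R (f j + f k)))\<^sup>2"
      unfolding power2_norm_eq_inner
      by (simp add: inner_simps inner_commute algebra_simps)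
    moreover have "d\<^sup>2 \<le> (norm (v - (1/2) *\<^sub>R (f j + f k)))\<^sup>2"
      using d_le[OF mid] d0 by (intro power_mono) auto
    ultimately show ?thesis
      using near[OF that(1)] near[OF that(2)] by (simp add: g_def)
  qed
  have "Cauchy f"
  proof (rule metric_CauchyI)
    fix e :: real assume e: "e > 0"
    then have "e\<^sup>2 > 0" by simp
    then have "\<forall>\<^sub>F n in sequentially. g n < e\<^sup>2" using g by (rule order_tendstoD(2)[rotated])
    then obtain N where N: "g N < e\<^sup>2" by (auto simp: eventually_sequentially)
    have "dist (f j) (f k) < e" if "j \<ge> N" "k \<ge> N" for j k
      using par[OF that] N e by (simp add: dist_norm power2_less_imp_less order_le_less_trans)
    then show "\<exists>N. \<forall>m\<ge>N. \<forall>n\<ge>N. dist (f m) (f n) < e" by blast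
  qed
  then obtain m where m: "f \<longlonglongrightarrow> m"
    using Cauchy_convergent_iff convergent_def by blast
  have mM: "m \<in> M" using closed_sequentially[OF assms(1)] fM m by blast
  have "norm (v - m) \<le> d + 0"
  proof (rule LIMSEQ_le)
    show "(\<lambda>n. norm (v - f n)) \<longlonglongrightarrow> norm (v - m)" by (intro tendsto_intros m)
    show "(\<lambda>n. d + inverse (real (Suc n))) \<longlonglongrightarrow> d + 0"
      by (intro tendsto_intros LIMSEQ_inverse_real_of_nat)
    show "\<exists>N. \<forall>n\<ge>N. norm (v - f n) \<le> d + inverse (real (Suc n))"
      using fd by (auto simp: dist_norm intro!: less_imp_le)
  qed
  then have nd: "norm (v - m) \<le> d" by simp
  have "inner w (v - m) = 0" if w: "w \<in> M" for w
  proof (rule ccontr)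
    assume ip: "inner w (v - m) \<noteq> 0"
    then have w0: "inner w w > 0" by auto
    \<comment> \<open>This \<open>t\<close> minimizes the distance from \<open>v - m\<close> to the
      line spanned by \<open>w\<close>; with a nonzero inner product, \<open>m + t w\<close> would
      be nearer to \<open>v\<close> than \<open>m\<close>.\<close>
    define t where "t = inner w (v - m) / inner w w"
    have "m + t *\<^sub>R w \<in> M" using assms(2) mM w by (simp add: subspace_add subspace_scale)
    then have "norm (v - m) \<le> norm (v - (m + t *\<^sub>R w))" using d_le nd by force
    then have "(norm (v - m))\<^sup>2 \<le> (norm ((v - m) - t *\<^sub>R w))\<^sup>2"
      by (simp add: algebra_simps)
    also have "\<dots> = (norm (v - m))\<^sup>2 - 2 * t * inner w (v - m) + t * (t * inner w w)"
      unfolding power2_norm_eq_inner by (simp add: inner_simps inner_commute algebra_simps)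
    also have "t * inner w w = inner w (v - m)" using w0 by (simp add: t_def)
    finally have "t * inner w (v - m) \<le> 0" by simp
    moreover have "t * inner w (v - m) = (inner w (v - m))\<^sup>2 / inner w w"
      by (simp add: t_def power2_eq_square)
    moreover have "\<dots> > 0" using ip w0 by (intro divide_pos_pos) auto
    ultimately show False by linarith
  qed
  moreover have "v - m \<noteq> 0" using v mM by auto
  ultimately show thesis using that by blast
qed

section \<open>Form bounds and norm bounds of symmetric operators\<close>

text \<open>Positivity is evaluated at \<open>u - C u / K\<close>, and the upper form bound at
  \<open>C u\<close> controls the last term of the expansion. This is the operator inequality
  \<open>C^2 \<le> K C\<close>.\<close>

lemma positive_operator_norm_le:
  fixes C :: "'a::real_inner \<Rightarrow> 'a"
  assumes lin: "linear C" and sym: "\<And>u v. inner (C u) v = inner u (C v)"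
    and pos: "\<And>u. 0 \<le> inner (C u) u" and le: "\<And>u. inner (C u) u \<le> K * (norm u)\<^sup>2"
    and K: "K > 0"
  shows "(norm (C u))\<^sup>2 \<le> K * inner (C u) u"
proof -
  have "inner (C (C u)) u = (norm (C u))\<^sup>2" using sym[of "C u" u] by (simp add: power2_norm_eq_inner)
  moreover have "inner (C u) (C u) = (norm (C u))\<^sup>2" by (simp add: power2_norm_eq_inner)
  moreover have "0 \<le> inner (C (u - (1/K) *\<^sub>R C u)) (u - (1/K) *\<^sub>R C u)" by (rule pos)
  ultimately have *: "0 \<le> inner (C u) u - 2 / K * (norm (C u))\<^sup>2 + 1/K * (1/K * inner (C (C u)) (C u))"
    by (simp add: linear_diff[OF lin] linear_scale[OF lin] inner_simps algebra_simps)
  have "1/K * (1/K * inner (C (C u)) (C u)) \<le> 1/K * (1/K * (K * (norm (C u))\<^sup>2))"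
    using le[of "C u"] K by (intro mult_left_mono) auto
  also have "1/K * (1/K * (K * (norm (C u))\<^sup>2)) = 1/K * (norm (C u))\<^sup>2" using K by simp
  finally have "1/K * (norm (C u))\<^sup>2 \<le> inner (C u) u"
    using * by linarith
  then show ?thesis using K by (simp add: field_simps)
qed

text \<open>Boundedness supplies \<open>K\<close> for \<open>positive_operator_norm_le\<close>,
  which converts the lower bound on the norm into one on the form.\<close>

lemma positive_operator_coercive:
  fixes C :: "'a::real_inner \<Rightarrow> 'a"
  assumes bl: "bounded_linear C" and sym: "\<And>u v. inner (C u) v = inner u (C v)"
    and pos: "\<And>u. 0 \<le> inner (C u) u"
    and \<kappa>: "\<kappa> > 0" "\<And>u. \<kappa> * norm u \<le> norm (C u)"
  obtains e where "e > 0" and "\<And>u. e * (norm u)\<^sup>2 \<le> inner (C u) u"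
proof -
  obtain K where K: "K > 0" "\<And>u. norm (C u) \<le> norm u * K"
    using bounded_linear.pos_bounded[OF bl] by blast
  have le: "inner (C u) u \<le> K * (norm u)\<^sup>2" for u
  proof -
    have "inner (C u) u \<le> norm (C u) * norm u" by (rule norm_cauchy_schwarz)
    also have "\<dots> \<le> (norm u * K) * norm u" by (intro mult_right_mono K) auto
    finally show ?thesis by (simp add: power2_eq_square algebra_simps)
  qed
  have "\<kappa>\<^sup>2 / K * (norm u)\<^sup>2 \<le> inner (C u) u" for u
  proof -
    have "(\<kappa> * norm u)\<^sup>2 \<le> (norm (C u))\<^sup>2" using \<kappa> by (intro power_mono) auto
    also have "\<dots> \<le> K * inner (C u) u"
      by (rule positive_operator_norm_le[OF bounded_linear.linear[OF bl] sym pos le K(1)])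
    finally show ?thesis using K by (simp add: field_simps power_mult_distrib)
  qed
  then show thesis using that[of "\<kappa>\<^sup>2 / K"] K \<kappa> by simp
qed

text \<open>For \<open>C = B - c\<close> the inequality \<open>C^2 \<le> (d - c) C\<close> holds,
  and completing the square around the midpoint \<open>(d - c)/2\<close> gives the claim.\<close>

lemma norm_center_le:
  fixes B :: "'a::real_inner \<Rightarrow> 'a"
  assumes lin: "linear B" and sym: "\<And>u v. inner (B u) v = inner u (B v)"
    and lo: "\<And>u. c * (norm u)\<^sup>2 \<le> inner (B u) u"
    and hi: "\<And>u. inner (B u) u \<le> d * (norm u)\<^sup>2" and cd: "c < d"
  shows "norm (B u - ((c + d) / 2) *\<^sub>R u) \<le> (d - c) / 2 * norm u"
proof -
  define C where "C u = B u - c *\<^sub>R u" for u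
  have "(norm (C u))\<^sup>2 \<le> (d - c) * inner (C u) u"
  proof (rule positive_operator_norm_le)
    show "linear C" unfolding C_def by (intro linear_compose_sub lin linear_scaleR)
    show "inner (C u) v = inner u (C v)" for u v
      by (simp add: C_def inner_simps sym)
    show "0 \<le> inner (C u) u" for u
      using lo[of u] by (simp add: C_def inner_simps power2_norm_eq_inner)
    show "inner (C u) u \<le> (d - c) * (norm u)\<^sup>2" for u
      using hi[of u] by (simp add: C_def inner_simps power2_norm_eq_inner algebra_simps)
  qed (use cd in simp)
  moreover have "B u - ((c + d) / 2) *\<^sub>R u = C u - ((d - c) / 2) *\<^sub>R u"
    by (simp add: C_def algebra_simps flip: scaleR_add_left) (simp add: field_simps)
  ultimately have "(norm (B u - ((c + d) / 2) *\<^sub>R u))\<^sup>2 \<le> ((d - c) / 2 * norm u)\<^sup>2"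
    unfolding power_mult_distrib power2_norm_eq_inner
    by (simp add: inner_simps inner_commute power2_eq_square)
  then show ?thesis using cd by (auto intro: power2_le_imp_le)
qed

text \<open>On vectors that almost attain the norm \<open>N\<close> of \<open>R\<close>, \<open>R\<^sup>2 - N\<^sup>2 = (R - N)(R + N)\<close> is small.\<close>

lemma norm_attained_in_approximate_spectrum:
  fixes R :: "'a::real_inner \<Rightarrow> 'a"
  assumes bl: "bounded_linear R" and sym: "\<And>u v. inner (R u) v = inner u (R v)"
    and N: "onorm R > 0" and c: "c > 0"
    and minus: "\<And>u. c * norm u \<le> norm (R u - onorm R *\<^sub>R u)"
    and plus: "\<And>u. c * norm u \<le> norm (R u + onorm R *\<^sub>R u)"
  shows False
proof -
  define N where "N = onorm R"
  have N0: "N > 0" using N by (simp add: N_def)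
  have bound: "norm (R u) \<le> N * norm u" for u unfolding N_def by (rule onorm[OF bl])
  have key: "N\<^sup>2 * (norm (R u))\<^sup>2 \<le> (N^4 - c^4) * (norm u)\<^sup>2" for u
  proof -
    let ?v = "R u + N *\<^sub>R u"
    \<comment> \<open>The two bounds are chained: \<open>plus\<close> at \<open>u\<close>, then
      \<open>minus\<close> at \<open>R u + N u\<close>, which bounds \<open>R^2 - N^2\<close> below
      by \<open>c^2\<close>.\<close>
    have "c * (c * norm u) \<le> c * norm ?v"
      using plus[of u] c by (intro mult_left_mono) (auto simp: N_def)
    also have "\<dots> \<le> norm (R ?v - N *\<^sub>R ?v)" using minus[of ?v] by (simp add: N_def)
    also have "R ?v - N *\<^sub>R ?v = R (R u) - N\<^sup>2 *\<^sub>R u"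
      using bounded_linear.linear[OF bl]
      by (simp add: linear_add linear_scale algebra_simps power2_eq_square)
    finally have "(c * (c * norm u))\<^sup>2 \<le> (norm (R (R u) - N\<^sup>2 *\<^sub>R u))\<^sup>2"
      using c by (intro power_mono) auto
    also have "\<dots> = (norm (R (R u)))\<^sup>2 - 2 * N\<^sup>2 * (norm (R u))\<^sup>2 + N^4 * (norm u)\<^sup>2"
      using sym[of "R u" u] unfolding power2_norm_eq_inner
      by (simp add: inner_simps inner_commute algebra_simps power2_eq_square power4_eq_xxxx)
    also have "(norm (R (R u)))\<^sup>2 \<le> (N * norm (R u))\<^sup>2"
      using bound by (intro power_mono) auto
    finally show ?thesis by (simp add: algebra_simps power_mult_distrib power2_eq_square power4_eq_xxxx)
  qed
  \<comment> \<open>By \<open>key\<close>, \<open>N'\<close> bounds \<open>R\<close> and is smaller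
    than \<open>N\<close>, although \<open>N\<close> is the operator norm; \<open>max 0\<close>
    keeps the argument of the root nonnegative.\<close>
  define N' where "N' = sqrt (max 0 (N\<^sup>2 - c^4 / N\<^sup>2))"
  have "norm (R u) \<le> N' * norm u" for u
  proof -
    have "(norm (R u))\<^sup>2 \<le> (N\<^sup>2 - c^4 / N\<^sup>2) * (norm u)\<^sup>2"
      using key[of u] N0 by (simp add: field_simps power2_eq_square power4_eq_xxxx)
    also have "\<dots> \<le> max 0 (N\<^sup>2 - c^4 / N\<^sup>2) * (norm u)\<^sup>2" by (intro mult_right_mono) auto
    also have "\<dots> = (N' * norm u)\<^sup>2" by (simp add: N'_def power_mult_distrib)
    finally show ?thesis by (rule power2_le_imp_le) (simp add: N'_def)
  qed
  then have "N \<le> N'" unfolding N_def by (intro onorm_bound) (simp_all add: N'_def)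
  moreover have "N' < N"
  proof -
    have "max 0 (N\<^sup>2 - c^4 / N\<^sup>2) < N\<^sup>2" using N0 c by simp
    then have "N' < sqrt (N\<^sup>2)" unfolding N'_def by (rule real_sqrt_less_mono)
    then show ?thesis using N0 by simp
  qed
  ultimately show False by simp
qed


section \<open>Self-adjoint operators\<close>

lemma inner_scaleC_left:
  fixes u v :: "'a::complex_hilbert_space"
  shows "inner (c *\<^sub>C u) v = inner u (cnj c *\<^sub>C v)"
proof -
  have "cinner u (cnj c *\<^sub>C v) = c * cnj (cinner v u)"
    by (subst cinner_commute) (simp add: cinner_scaleC_left)
  also have "cnj (cinner v u) = cinner u v" by (rule cinner_commute[symmetric])
  finally show ?thesis by (simp add: cinner_scaleC_left flip: Re_cinner)
qed

lemma inner_imaginary_left: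
  fixes u v :: "'a::complex_hilbert_space"
  shows "inner (\<i> *\<^sub>C u) v = - inner u (\<i> *\<^sub>C v)"
  by (simp add: inner_scaleC_left complex_vector.scale_minus_left)

lemma imaginary_imaginary:
  fixes u :: "'a::complex_hilbert_space"
  shows "\<i> *\<^sub>C \<i> *\<^sub>C u = - u"
  by (simp add: scaleC_scaleC complex_vector.scale_minus_left scaleC_one)

lemma norm_imaginary:
  fixes u :: "'a::complex_hilbert_space"
  shows "norm (\<i> *\<^sub>C u) = norm u"
  unfolding norm_eq_sqrt_inner by (simp add: inner_imaginary_left imaginary_imaginary)

lemma scaleC_complex_decompose:
  fixes u :: "'a::complex_hilbert_space"
  shows "z *\<^sub>C u = Re z *\<^sub>R u + Im z *\<^sub>R (\<i> *\<^sub>C u)"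
proof -
  have "z = complex_of_real (Re z) + complex_of_real (Im z) * \<i>"
    by (simp add: complex_eq_iff)
  then have "z *\<^sub>C u = (complex_of_real (Re z) + complex_of_real (Im z) * \<i>) *\<^sub>C u"
    by (rule arg_cong)
  also have "\<dots> = complex_of_real (Re z) *\<^sub>C u + complex_of_real (Im z) *\<^sub>C \<i> *\<^sub>C u"
    by (simp only: scaleC_add_left scaleC_scaleC)
  finally show ?thesis by (simp only: scaleC_of_real)
qed

lemma scaleC_scaleR_commute:
  fixes u :: "'a::complex_hilbert_space"
  shows "c *\<^sub>C (r *\<^sub>R u) = r *\<^sub>R (c *\<^sub>C u)"
  by (simp only: scaleC_scaleC mult.commute flip: scaleC_of_real)

lemma bounded_linear_imaginary:
  "bounded_linear (\<lambda>u. \<i> *\<^sub>C (u :: 'a::complex_hilbert_space))"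
  by (rule bounded_linear_intro[where K = 1])
    (simp_all add: scaleC_add_right scaleC_scaleR_commute norm_imaginary)

lemma inner_imaginary_self:
  fixes u :: "'a::complex_hilbert_space"
  shows "inner u (\<i> *\<^sub>C u) = 0"
  using inner_imaginary_left[of u u] by (simp add: inner_commute)

section \<open>Symmetry, closedness and perturbations of a self-adjoint operator\<close>

context
  fixes D :: "'a::complex_hilbert_space set" and A :: "'a \<Rightarrow> 'a"
  assumes sa: "self_adjoint D A"
begin

lemma self_adjoint_add: "u \<in> D \<Longrightarrow> v \<in> D \<Longrightarrow> A (u + v) = A u + A v"
  and self_adjoint_scaleC: "u \<in> D \<Longrightarrow> A (c *\<^sub>C u) = c *\<^sub>C A u"
  and self_adjoint_mem_add: "u \<in> D \<Longrightarrow> v \<in> D \<Longrightarrow> u + v \<in> D"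
  and self_adjoint_mem_scaleC: "u \<in> D \<Longrightarrow> c *\<^sub>C u \<in> D"
  and self_adjoint_mem_zero: "0 \<in> D"
  and self_adjoint_dense: "closure D = UNIV"
  using sa unfolding self_adjoint_def linear_operator_def complex_vector.subspace_def by auto

lemma self_adjoint_scaleR: "u \<in> D \<Longrightarrow> A (r *\<^sub>R u) = r *\<^sub>R A u"
  and self_adjoint_mem_scaleR: "u \<in> D \<Longrightarrow> r *\<^sub>R u \<in> D"
  using self_adjoint_scaleC[of u "complex_of_real r"] self_adjoint_mem_scaleC[of u "complex_of_real r"]
  by (simp_all add: scaleC_of_real)

lemma self_adjoint_diff: "u \<in> D \<Longrightarrow> v \<in> D \<Longrightarrow> A (u - v) = A u - A v"
  and self_adjoint_mem_diff: "u \<in> D \<Longrightarrow> v \<in> D \<Longrightarrow> u - v \<in> D"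
  using self_adjoint_add[of u "(-1) *\<^sub>R v"] self_adjoint_scaleR[of v "-1"]
    self_adjoint_mem_scaleR[of v "-1"] self_adjoint_mem_add[of u "(-1) *\<^sub>R v"]
  by simp_all

lemma self_adjoint_cinner:
  assumes "u \<in> D" "v \<in> D"
  shows "cinner (A u) v = cinner u (A v)"
proof -
  have "(v, A v) \<in> adjoint_graph D A" using sa assms by (auto simp: self_adjoint_def)
  then show ?thesis using assms by (auto simp: adjoint_graph_def)
qed

lemma self_adjoint_inner:
  assumes "u \<in> D" "v \<in> D"
  shows "inner (A u) v = inner u (A v)"
  using self_adjoint_cinner[OF assms] by (metis Re_cinner)

lemma self_adjoint_cinner_self:
  assumes "u \<in> D"
  shows "cinner (A u) u = complex_of_real (inner (A u) u)"
proof -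
  have "cinner (A u) u = cnj (cinner (A u) u)"
    using self_adjoint_cinner[OF assms assms] by (metis cinner_commute)
  then have "Im (cinner (A u) u) = 0" by (metis cnj.simps(2) neg_equal_zero)
  then show ?thesis by (simp add: complex_eq_iff Re_cinner)
qed

text \<open>Real form of the fact that \<open>cinner (A u) u\<close> has no imaginary part:
  \<open>A\<close> is symmetric and commutes with \<i>, which is skew.\<close>

lemma self_adjoint_inner_imaginary:
  assumes "u \<in> D"
  shows "inner (A u) (\<i> *\<^sub>C u) = 0"
proof -
  have "inner (A u) (\<i> *\<^sub>C u) = inner u (\<i> *\<^sub>C A u)"
    using assms by (simp add: self_adjoint_inner self_adjoint_mem_scaleC self_adjoint_scaleC)
  also have "\<dots> = - inner (A u) (\<i> *\<^sub>C u)"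
    by (metis inner_commute inner_imaginary_left)
  finally show ?thesis by simp
qed

text \<open>The real inner product already determines the adjoint, since \<open>D\<close> is invariant under \<open>\<i>\<close>.\<close>

lemma self_adjoint_maximal:
  assumes "\<And>u. u \<in> D \<Longrightarrow> inner (A u) v = inner u w"
  shows "v \<in> D" and "A v = w"
proof -
  have "cinner (A u) v = cinner u w" if u: "u \<in> D" for u
  proof (rule complex_eqI)
    show "Re (cinner (A u) v) = Re (cinner u w)" using assms[OF u] by (simp add: Re_cinner)
    have "Re (cinner (\<i> *\<^sub>C A u) v) = Re (cinner (\<i> *\<^sub>C u) w)"
      using assms[of "\<i> *\<^sub>C u"] u
      by (simp add: Re_cinner self_adjoint_mem_scaleC self_adjoint_scaleC)
    then show "Im (cinner (A u) v) = Im (cinner u w)" by (simp add: cinner_scaleC_left)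
  qed
  then have "(v, w) \<in> adjoint_graph D A" by (auto simp: adjoint_graph_def)
  then show "v \<in> D" "A v = w" using sa by (auto simp: self_adjoint_def)
qed

text \<open>The symmetry relation passes to the limit, and maximality then puts the limit into the
  domain.\<close>

lemma self_adjoint_closed:
  assumes "\<And>n. f n \<in> D" and "f \<longlonglongrightarrow> v" and "(\<lambda>n. A (f n)) \<longlonglongrightarrow> w"
  shows "v \<in> D" and "A v = w"
proof -
  have "inner (A u) v = inner u w" if u: "u \<in> D" for u
  proof (rule LIMSEQ_unique)
    show "(\<lambda>n. inner (A u) (f n)) \<longlonglongrightarrow> inner (A u) v" by (intro tendsto_intros assms)
    have "(\<lambda>n. inner u (A (f n))) \<longlonglongrightarrow> inner u w" by (intro tendsto_intros assms)
    then show "(\<lambda>n. inner (A u) (f n)) \<longlonglongrightarrow> inner u w"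
      using self_adjoint_inner[OF u assms(1)] by simp
  qed
  then show "v \<in> D" "A v = w" using self_adjoint_maximal by blast+
qed

text \<open>Images of an approximating sequence are Cauchy, so density and closedness exhaust the
  space. The exchange of \<open>A\<close> and \<open>B\<close> relies on this, because the operator
  in the role of \<open>B\<close> is defined everywhere.\<close>

lemma self_adjoint_bounded_domain:
  assumes "bounded_operator D A"
  shows "D = UNIV"
proof -
  obtain K where K: "\<And>u. u \<in> D \<Longrightarrow> norm (A u) \<le> K * norm u"
    using assms by (auto simp: bounded_operator_def)
  \<comment> \<open>The given \<open>K\<close> may be zero or negative; \<open>L\<close> is
    positive, so that \<open>e / L\<close> makes sense below.\<close>
  define L where "L = max K 1"
  have L: "L > 0" by (simp add: L_def)
  have KL: "norm (A u) \<le> L * norm u" if "u \<in> D" for u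
  proof -
    have "K * norm u \<le> L * norm u" by (rule mult_right_mono) (simp_all add: L_def)
    then show ?thesis using K[OF that] by linarith
  qed
  have "v \<in> D" for v
  proof -
    have "v \<in> closure D" using self_adjoint_dense by simp
    then obtain f where f: "\<And>n. f n \<in> D" "f \<longlonglongrightarrow> v" by (auto simp: closure_sequential)
    have "Cauchy (\<lambda>n. A (f n))"
    proof (rule metric_CauchyI)
      fix e :: real assume "e > 0"
      then have "e / L > 0" using L by simp
      moreover have "Cauchy f" using f(2) LIMSEQ_imp_Cauchy by blast
      ultimately obtain N where N: "\<And>m n. m \<ge> N \<Longrightarrow> n \<ge> N \<Longrightarrow> dist (f m) (f n) < e / L"
        using metric_CauchyD by metis
      have "dist (A (f m)) (A (f n)) < e" if "m \<ge> N" "n \<ge> N" for m n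
      proof -
        have "dist (A (f m)) (A (f n)) \<le> L * dist (f m) (f n)"
          using KL[OF self_adjoint_mem_diff[OF f(1) f(1)], of m n] f(1)
          by (simp add: dist_norm self_adjoint_diff)
        also have "\<dots> < L * (e / L)" using N[OF that] L by (intro mult_strict_left_mono)
        finally show ?thesis using L by simp
      qed
      then show "\<exists>N. \<forall>m\<ge>N. \<forall>n\<ge>N. dist (A (f m)) (A (f n)) < e" by blast
    qed
    then obtain w where "(\<lambda>n. A (f n)) \<longlonglongrightarrow> w"
      using Cauchy_convergent_iff convergent_def by blast
    then show "v \<in> D" using self_adjoint_closed f by blast
  qed
  then show ?thesis by blast
qed

text \<open>\<open>A + S\<close> has closed range by the lower bound, and the orthogonal complement of its range is
  the kernel of \<open>A + S'\<close>.\<close>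

lemma self_adjoint_perturbation_bijective:
  assumes S: "bounded_linear S" and adj: "\<And>u v. inner (S u) v = inner u (S' v)"
    and \<kappa>: "\<kappa> > 0" and lower: "\<And>u. u \<in> D \<Longrightarrow> \<kappa> * norm u \<le> norm (A u + S u)"
    and ker: "\<And>u. u \<in> D \<Longrightarrow> A u + S' u = 0 \<Longrightarrow> u = 0"
  shows "bij_betw (\<lambda>u. A u + S u) D UNIV" and "bounded_linear (inv_into D (\<lambda>u. A u + S u))"
proof -
  define T where "T u = A u + S u" for u
  note Slin = bounded_linear.linear[OF S]
  have Tadd: "T (u + v) = T u + T v" if "u \<in> D" "v \<in> D" for u v
    using that by (simp add: T_def self_adjoint_add linear_add[OF Slin])
  have Tdiff: "T (u - v) = T u - T v" if "u \<in> D" "v \<in> D" for u v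
    using that by (simp add: T_def self_adjoint_diff linear_diff[OF Slin])
  have Tscale: "T (r *\<^sub>R u) = r *\<^sub>R T u" if "u \<in> D" for u r
    using that by (simp add: T_def self_adjoint_scaleR linear_scale[OF Slin] scaleR_add_right)
  have low: "\<kappa> * norm (u - v) \<le> norm (T u - T v)" if "u \<in> D" "v \<in> D" for u v
    using lower[OF self_adjoint_mem_diff[OF that]] Tdiff[OF that] by (simp add: T_def)
  have inj: "inj_on T D"
  proof (rule inj_onI)
    fix u v assume "u \<in> D" "v \<in> D" "T u = T v"
    then have "\<kappa> * norm (u - v) \<le> 0" using low[of u v] by simp
    then show "u = v" using \<kappa> by (simp add: mult_le_0_iff)
  qed
  have sub: "subspace (T ` D)"
  proof (rule subspaceI)
    show "0 \<in> T ` D" using Tscale[OF self_adjoint_mem_zero, of 0] self_adjoint_mem_zero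
      by (auto intro!: image_eqI[of _ _ 0])
    fix p q r assume "p \<in> T ` D" "q \<in> T ` D"
    then show "p + q \<in> T ` D" "r *\<^sub>R p \<in> T ` D"
      using Tadd Tscale self_adjoint_mem_add self_adjoint_mem_scaleR unfolding image_iff by metis+
  qed
  have "closed (T ` D)"
    unfolding closed_sequential_limits
  proof (intro allI impI, elim conjE)
    fix g w assume g: "\<forall>n. g n \<in> T ` D" and gw: "g \<longlonglongrightarrow> w"
    have "\<forall>n. \<exists>u. u \<in> D \<and> g n = T u" using g by blast
    then obtain f where f: "\<And>n. f n \<in> D" "\<And>n. g n = T (f n)" by metis
    have "Cauchy f"
    proof (rule metric_CauchyI)
      fix e :: real assume "e > 0"
      then have "\<kappa> * e > 0" using \<kappa> by simp
      moreover have "Cauchy g" using gw LIMSEQ_imp_Cauchy by blast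
      ultimately obtain N where N: "\<And>m n. m \<ge> N \<Longrightarrow> n \<ge> N \<Longrightarrow> dist (g m) (g n) < \<kappa> * e"
        using metric_CauchyD by metis
      have "dist (f m) (f n) < e" if "m \<ge> N" "n \<ge> N" for m n
      proof -
        have "\<kappa> * dist (f m) (f n) < \<kappa> * e"
          using low[OF f(1) f(1), of m n] N[OF that] f(2) by (simp add: dist_norm)
        then show ?thesis using \<kappa> by simp
      qed
      then show "\<exists>N. \<forall>m\<ge>N. \<forall>n\<ge>N. dist (f m) (f n) < e" by blast
    qed
    then obtain v where v: "f \<longlonglongrightarrow> v" using Cauchy_convergent_iff convergent_def by blast
    \<comment> \<open>Continuity of \<open>S\<close> isolates the images under \<open>A\<close>, so
      that closedness of \<open>A\<close> identifies the limit.\<close>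
    have "(\<lambda>n. g n - S (f n)) \<longlonglongrightarrow> w - S v"
      by (intro tendsto_intros gw bounded_linear.tendsto[OF S] v)
    then have "(\<lambda>n. A (f n)) \<longlonglongrightarrow> w - S v" by (simp add: f T_def)
    then have "v \<in> D" "A v = w - S v" using self_adjoint_closed[of f] f(1) v by blast+
    then show "w \<in> T ` D" by (intro image_eqI[of _ _ v]) (auto simp: T_def)
  qed
  have range: "T ` D = UNIV"
  proof (rule ccontr)
    assume proper: "T ` D \<noteq> UNIV"
    obtain y where y: "y \<noteq> 0" "\<And>m. m \<in> T ` D \<Longrightarrow> inner m y = 0"
      by (rule closed_subspace_orthogonal_vector[OF \<open>closed (T ` D)\<close> sub proper]) blast
    \<comment> \<open>Orthogonality to the range is the adjoint relation for the pair
      \<open>y\<close>, \<open>- S' y\<close>; maximality puts \<open>y\<close> into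
      \<open>D\<close>, where \<open>ker\<close> forces \<open>y = 0\<close>.\<close>
    have "inner (A u) y = inner u (- S' y)" if "u \<in> D" for u
      using y(2)[of "T u"] that by (simp add: T_def inner_add_left adj add_eq_0_iff2)
    then have "y \<in> D" "A y = - S' y" using self_adjoint_maximal by blast+
    then show False using ker[of y] y(1) by simp
  qed
  show bij: "bij_betw (\<lambda>u. A u + S u) D UNIV"
    using inj range by (auto simp: bij_betw_def T_def[abs_def])
  define R where "R = inv_into D T"
  have RD: "R p \<in> D" and TR: "T (R p) = p" for p
    using range by (simp_all add: R_def inv_into_into f_inv_into_f)
  have RT: "R (T u) = u" if "u \<in> D" for u using inj that by (simp add: R_def)
  have "bounded_linear R"
  proof (rule bounded_linear_intro[where K = "1 / \<kappa>"])
    show "R (p + q) = R p + R q" for p q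
      using RT[OF self_adjoint_mem_add[OF RD RD], of p q] by (simp add: Tadd RD TR)
    show "R (r *\<^sub>R p) = r *\<^sub>R R p" for p r
      using RT[OF self_adjoint_mem_scaleR[OF RD], of r p] by (simp add: Tscale RD TR)
    show "norm (R p) \<le> norm p * (1 / \<kappa>)" for p
      using lower[OF RD, of p] TR[of p] \<kappa> by (simp add: T_def field_simps)
  qed
  then show "bounded_linear (inv_into D (\<lambda>u. A u + S u))" by (simp add: R_def T_def[abs_def])
qed

text \<open>For real \<open>t\<close> the shift is its own adjoint, so one lower bound gives both
  the closed range and the trivial kernel; conversely a bounded inverse yields \<kappa>. Spectral
  questions at real points thus become norm estimates.\<close>

lemma resolvent_set_real_iff:
  "complex_of_real t \<in> resolvent_set D A \<longleftrightarrow>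
    (\<exists>\<kappa>>0. \<forall>u\<in>D. \<kappa> * norm u \<le> norm (A u - t *\<^sub>R u))"
proof
  assume t: "complex_of_real t \<in> resolvent_set D A"
  let ?T = "\<lambda>u. A u - t *\<^sub>R u"
  from t have bij: "bij_betw ?T D UNIV" and bl: "bounded_linear (inv_into D ?T)"
    by (auto simp: resolvent_set_def scaleC_of_real)
  obtain K where K: "K > 0" "\<And>p. norm (inv_into D ?T p) \<le> norm p * K"
    using bounded_linear.pos_bounded[OF bl] by blast
  have "1 / K * norm u \<le> norm (?T u)" if "u \<in> D" for u
    using K(2)[of "?T u"] inv_into_f_f[OF bij_betw_imp_inj_on[OF bij] that] K(1)
    by (simp add: field_simps)
  then show "\<exists>\<kappa>>0. \<forall>u\<in>D. \<kappa> * norm u \<le> norm (A u - t *\<^sub>R u)"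
    using K(1) by (intro exI[of _ "1 / K"]) auto
next
  assume "\<exists>\<kappa>>0. \<forall>u\<in>D. \<kappa> * norm u \<le> norm (A u - t *\<^sub>R u)"
  then obtain \<kappa> where \<kappa>: "\<kappa> > 0" "\<And>u. u \<in> D \<Longrightarrow> \<kappa> * norm u \<le> norm (A u - t *\<^sub>R u)" by blast
  let ?S = "\<lambda>u. - (t *\<^sub>R u)"
  have S: "bounded_linear ?S" by (intro bounded_linear_minus bounded_linear_scaleR_right)
  have adj: "inner (?S u) v = inner u (?S v)" for u v by simp
  have ker: "u = 0" if "u \<in> D" "A u + ?S u = 0" for u
  proof -
    have "\<kappa> * norm u \<le> 0" using \<kappa>(2)[OF that(1)] that(2) by simp
    then show ?thesis using \<kappa>(1) by (simp add: mult_le_0_iff)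
  qed
  have lower: "\<kappa> * norm u \<le> norm (A u + ?S u)" if "u \<in> D" for u using \<kappa>(2)[OF that] by simp
  have eq: "(\<lambda>u. A u - complex_of_real t *\<^sub>C u) = (\<lambda>u. A u + ?S u)" by (simp add: scaleC_of_real)
  show "complex_of_real t \<in> resolvent_set D A"
    unfolding resolvent_set_def mem_Collect_eq eq
    by (intro conjI self_adjoint_perturbation_bijective[OF S adj \<kappa>(1) lower ker])
qed

end


section \<open>Extreme spectral points of bounded self-adjoint operators\<close>

lemma self_adjoint_bounded_linear:
  assumes "self_adjoint UNIV B" and "bounded_operator UNIV B"
  shows "bounded_linear B"
proof -
  obtain K where "\<And>u. norm (B u) \<le> K * norm u"
    using assms(2) by (auto simp: bounded_operator_def)
  then show ?thesis
    using self_adjoint_add[OF assms(1)] self_adjoint_scaleR[OF assms(1)]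
    by (intro bounded_linear_intro[where K = K]) (auto simp: mult.commute)
qed

text \<open>Serves to read off the top of the spectrum of \<open>B\<close> from the bottom of that
  of \<open>- B\<close>.\<close>

lemma self_adjoint_uminus:
  fixes B :: "'a::complex_hilbert_space \<Rightarrow> 'a"
  assumes "self_adjoint UNIV B"
  shows "self_adjoint UNIV (\<lambda>u. - B u)"
proof -
  have neg: "cinner (- x) y = - cinner x y" "cinner x (- y) = - cinner x y" for x y :: 'a
  proof -
    show "cinner (- x) y = - cinner x y" for x y :: 'a
      using cinner_scaleC_left[of "-1" x y] by (simp add: complex_vector.scale_minus_left scaleC_one)
    then show "cinner x (- y) = - cinner x y" by (metis cinner_commute complex_cnj_minus)
  qed
  have "(y, w) \<in> adjoint_graph UNIV (\<lambda>u. - B u) \<longleftrightarrow> (y, - w) \<in> adjoint_graph UNIV B" for y w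
    by (simp add: adjoint_graph_def neg) (metis minus_minus)
  also have "(y, - w) \<in> adjoint_graph UNIV B \<longleftrightarrow> w = - B y" for y w
    using assms by (auto simp: self_adjoint_def) (metis minus_minus)
  finally have "adjoint_graph UNIV (\<lambda>u. - B u) = {(u, - B u) | u. u \<in> UNIV}" by auto
  then show ?thesis
    using assms by (auto simp: self_adjoint_def linear_operator_def complex_vector.scale_minus_right)
qed

lemma spectrum_uminus_real_iff:
  assumes "self_adjoint UNIV B"
  shows "complex_of_real t \<in> spectrum UNIV (\<lambda>u. - B u) \<longleftrightarrow> complex_of_real (- t) \<in> spectrum UNIV B"
proof -
  have "norm (- B u - t *\<^sub>R u) = norm (B u - (- t) *\<^sub>R u)" for u
    using norm_minus_cancel[of "B u + t *\<^sub>R u"] by simp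
  then show ?thesis
    unfolding spectrum_def Compl_iff resolvent_set_real_iff[OF self_adjoint_uminus[OF assms]]
      resolvent_set_real_iff[OF assms] by simp
qed

text \<open>The constant is the infimum of the form over unit vectors, which exist because of
  \<open>v\<close>. If it were a resolvent point, the form of \<open>B - c\<close> would be coercive
  and the infimum larger; at points below it the form bound becomes a norm bound.\<close>

lemma quadratic_form_lower_bound:
  fixes B :: "'a::complex_hilbert_space \<Rightarrow> 'a"
  assumes sa: "self_adjoint UNIV B" and bd: "bounded_operator UNIV B" and "(v :: 'a) \<noteq> 0"
  obtains c where "complex_of_real c \<in> spectrum UNIV B"
    and "\<And>t. complex_of_real t \<in> spectrum UNIV B \<Longrightarrow> c \<le> t"
    and "\<And>u. c * (norm u)\<^sup>2 \<le> inner (B u) u"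
proof -
  note bl = self_adjoint_bounded_linear[OF sa bd]
  note sym = self_adjoint_inner[OF sa UNIV_I UNIV_I]
  define W where "W = {inner (B u) u | u. norm u = 1}"
  have ne: "W \<noteq> {}" using \<open>v \<noteq> 0\<close> by (auto simp: W_def intro!: exI[of _ "sgn v"] simp: norm_sgn)
  obtain K where K: "\<And>u. norm (B u) \<le> norm u * K" using bounded_linear.bounded[OF bl] by blast
  have "- K \<le> w" if w: "w \<in> W" for w
  proof -
    obtain u where u: "norm u = 1" "w = inner (B u) u" using w by (auto simp: W_def)
    have "\<bar>w\<bar> \<le> norm (B u) * norm u" unfolding u(2) by (rule Cauchy_Schwarz_ineq2)
    then show ?thesis using K[of u] u(1) by simp
  qed
  then have bdd: "bdd_below W" by (rule bdd_belowI)
  define c where "c = Inf W"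
  have low: "c * (norm u)\<^sup>2 \<le> inner (B u) u" for u
  proof (cases "u = 0")
    case False
    have "inner (B (sgn u)) (sgn u) \<in> W" using False by (auto simp: W_def norm_sgn)
    then have "c \<le> inner (B (sgn u)) (sgn u)" unfolding c_def by (rule cInf_lower[OF _ bdd])
    also have "\<dots> = inner (B u) u / (norm u)\<^sup>2"
      by (simp add: sgn_div_norm linear_scale[OF bounded_linear.linear[OF bl]] power2_eq_square field_simps)
    finally show ?thesis using False by (simp add: field_simps)
  qed (simp add: linear_0[OF bounded_linear.linear[OF bl]])
  have "complex_of_real c \<notin> resolvent_set UNIV B"
  proof
    assume "complex_of_real c \<in> resolvent_set UNIV B"
    then obtain \<kappa> where \<kappa>: "\<kappa> > 0" "\<And>u. \<kappa> * norm u \<le> norm (B u - c *\<^sub>R u)"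
      unfolding resolvent_set_real_iff[OF sa] by blast
    obtain e where e: "e > 0" "\<And>u. e * (norm u)\<^sup>2 \<le> inner (B u - c *\<^sub>R u) u"
    proof (rule positive_operator_coercive[of "\<lambda>u. B u - c *\<^sub>R u"])
      show "bounded_linear (\<lambda>u. B u - c *\<^sub>R u)"
        by (intro bounded_linear_sub bl bounded_linear_scaleR_right)
      show "inner (B u - c *\<^sub>R u) v = inner u (B v - c *\<^sub>R v)" for u v
        by (simp add: inner_diff_left inner_diff_right sym)
      show "0 \<le> inner (B u - c *\<^sub>R u) u" for u
        using low[of u] by (simp add: inner_diff_left power2_norm_eq_inner)
    qed (use \<kappa> in auto)
    have "c + e \<le> w" if w: "w \<in> W" for w
    proof -
      obtain u where u: "norm u = 1" "w = inner (B u) u" using w by (auto simp: W_def)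
      have "inner u u = 1" using u(1) by (simp add: norm_eq_1)
      then show ?thesis using e(2)[of u] u by (simp add: inner_diff_left)
    qed
    then have "c + e \<le> c" unfolding c_def by (intro cInf_greatest ne)
    then show False using e(1) by simp
  qed
  moreover have "c \<le> t" if "complex_of_real t \<in> spectrum UNIV B" for t
  proof (rule ccontr)
    assume "\<not> c \<le> t"
    then have t: "c - t > 0" by simp
    have "(c - t) * norm u \<le> norm (B u - t *\<^sub>R u)" for u
    proof (cases "u = 0")
      case False
      have "(c - t) * norm u * norm u \<le> inner (B u - t *\<^sub>R u) u"
        using low[of u]
        by (simp add: inner_diff_left algebra_simps power2_eq_square flip: power2_norm_eq_inner)
      also have "\<dots> \<le> norm (B u - t *\<^sub>R u) * norm u" by (rule norm_cauchy_schwarz)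
      finally show ?thesis using False by simp
    qed simp
    then have "complex_of_real t \<in> resolvent_set UNIV B"
      unfolding resolvent_set_real_iff[OF sa] using t by blast
    then show False using that by (simp add: spectrum_def)
  qed
  ultimately show thesis using that low by (simp add: spectrum_def)
qed

text \<open>\<open>LEAST\<close> and \<open>GREATEST\<close> can be evaluated once an attained
  extremum is exhibited. \<open>quadratic_form_lower_bound\<close> provides it at the bottom and,
  applied to \<open>- B\<close>, at the top.\<close>

lemma quadratic_form_spectrum_bounds:
  fixes B :: "'a::complex_hilbert_space \<Rightarrow> 'a"
  assumes sa: "self_adjoint UNIV B" and bd: "bounded_operator UNIV B" and "(v :: 'a) \<noteq> 0"
  shows "min_spectrum UNIV B * (norm u)\<^sup>2 \<le> inner (B u) u"
    and "inner (B u) u \<le> max_spectrum UNIV B * (norm u)\<^sup>2"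
proof -
  obtain c where c: "complex_of_real c \<in> spectrum UNIV B"
      "\<And>t. complex_of_real t \<in> spectrum UNIV B \<Longrightarrow> c \<le> t"
      "\<And>u. c * (norm u)\<^sup>2 \<le> inner (B u) u"
    by (rule quadratic_form_lower_bound[OF assms]) blast
  have "min_spectrum UNIV B = c"
    unfolding min_spectrum_def by (rule Least_equality) (use c in auto)
  then show "min_spectrum UNIV B * (norm u)\<^sup>2 \<le> inner (B u) u" using c(3) by simp
  have neg: "bounded_operator UNIV (\<lambda>u. - B u)" using bd by (simp add: bounded_operator_def)
  obtain d where d: "complex_of_real d \<in> spectrum UNIV (\<lambda>u. - B u)"
      "\<And>t. complex_of_real t \<in> spectrum UNIV (\<lambda>u. - B u) \<Longrightarrow> d \<le> t"
      "\<And>u. d * (norm u)\<^sup>2 \<le> inner (- B u) u"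
    by (rule quadratic_form_lower_bound[OF self_adjoint_uminus[OF sa] neg \<open>v \<noteq> 0\<close>]) blast
  have "max_spectrum UNIV B = - d"
    unfolding max_spectrum_def
  proof (rule Greatest_equality)
    show "complex_of_real (- d) \<in> spectrum UNIV B"
      using d(1) by (simp add: spectrum_uminus_real_iff[OF sa])
    show "t \<le> - d" if "complex_of_real t \<in> spectrum UNIV B" for t
      using d(2)[of "- t"] that spectrum_uminus_real_iff[OF sa, of "- t"] by simp
  qed
  then show "inner (B u) u \<le> max_spectrum UNIV B * (norm u)\<^sup>2" using d(3)[of u] by simp
qed

text \<open>Applied to the inverse \<open>R\<close> of \<open>A - (a + b)/2\<close>: if \<open>R\<close> had norm \<open>N > 2/(b - a)\<close>, one of
  \<open>(a + b)/2 \<plusminus> 1/N\<close> would be a spectral point of \<open>A\<close> in the gap.\<close>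

lemma resolvent_gap_lower_bound:
  assumes sa: "self_adjoint D A" and ab: "a < b"
    and gap: "complex_of_real ` {a<..<b} \<subseteq> resolvent_set D A" and u: "u \<in> D"
  shows "(b - a) / 2 * norm u \<le> norm (A u - ((a + b) / 2) *\<^sub>R u)"
proof -
  define m r where "m = (a + b) / 2" and "r = (b - a) / 2"
  have r: "r > 0" using ab by (simp add: r_def)
  have "m \<in> {a<..<b}" using ab by (simp add: m_def)
  then have m: "complex_of_real m \<in> resolvent_set D A" using gap by blast
  define T where "T u = A u - m *\<^sub>R u" for u
  define R where "R = inv_into D T"
  have bij: "bij_betw T D UNIV" and bl: "bounded_linear R"
    using m
    by (auto simp: resolvent_set_def scaleC_of_real T_def[abs_def] R_def)
  have RD: "R p \<in> D" and TR: "T (R p) = p" for p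
    using bij by (simp_all add: R_def bij_betw_def inv_into_into f_inv_into_f)
  have RT: "R (T u) = u" if "u \<in> D" for u using bij that by (simp add: R_def bij_betw_def)
  have sym: "inner (R p) q = inner p (R q)" for p q
  proof -
    have "inner (T (R p)) (R q) = inner (R p) (T (R q))"
      by (simp add: T_def inner_diff_left inner_diff_right self_adjoint_inner[OF sa RD RD])
    then show ?thesis by (simp add: TR)
  qed
  define N where "N = onorm R"
  have N0: "N \<ge> 0" unfolding N_def by (rule onorm_pos_le[OF bl])
  have "N \<le> 1 / r"
  proof (rule ccontr)
    assume "\<not> N \<le> 1 / r"
    then have Nr: "1 / r < N" by simp
    then have N: "N > 0" using r by (meson divide_pos_pos less_trans zero_less_one)
    then have rN: "1 / N < r" using Nr r by (simp add: field_simps)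
    \<comment> \<open>The sign \<open>s\<close> treats both candidates \<open>N\<close> and
      \<open>- N\<close> for an approximate eigenvalue of \<open>R\<close>; \<open>s N\<close>
      corresponds to the point \<open>m + s / N\<close> for \<open>A\<close>.\<close>
    have near: "\<exists>c>0. \<forall>p. c * norm p \<le> norm (R p - (s * N) *\<^sub>R p)" if s: "s = 1 \<or> s = -1" for s
    proof -
      have "m + s / N \<in> {a<..<b}" using s rN N by (auto simp: m_def r_def field_simps)
      then have "complex_of_real (m + s / N) \<in> resolvent_set D A" using gap by blast
      then obtain \<kappa> where \<kappa>: "\<kappa> > 0" "\<And>u. u \<in> D \<Longrightarrow> \<kappa> * norm u \<le> norm (A u - (m + s / N) *\<^sub>R u)"
        unfolding resolvent_set_real_iff[OF sa] by blast
      \<comment> \<open>\<open>L\<close> is the constant in the later bound of \<open>norm p\<close>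
        by \<open>norm e\<close>, where \<open>p = e + (s / N) w\<close> and \<kappa> controls
        \<open>w\<close>; moreover \<open>R p - s N p = - s N e\<close>.\<close>
      define L where "L = 1 + 1 / (N * \<kappa>)"
      have L: "L > 0" using N \<kappa>(1) by (simp add: L_def add_pos_pos)
      have "N / L * norm p \<le> norm (R p - (s * N) *\<^sub>R p)" for p
      proof -
        define w e where "w = R p" and "e = A w - (m + s / N) *\<^sub>R w"
        have w: "w \<in> D" "p = T w" by (simp_all add: w_def RD TR)
        have p: "p = e + (s / N) *\<^sub>R w" by (simp add: w(2) T_def e_def algebra_simps)
        have ss: "s * s = 1" using s by auto
        have "R p - (s * N) *\<^sub>R p = - (s * N) *\<^sub>R e"
          unfolding w_def[symmetric] using N ss by (simp add: p scaleR_add_right)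
        then have n: "norm (R p - (s * N) *\<^sub>R p) = N * norm e" using s N by auto
        have "norm p \<le> norm e + 1 / N * norm w"
          unfolding p using norm_triangle_ineq[of e "(s / N) *\<^sub>R w"] s N by auto
        also have "1 / N * norm w \<le> 1 / N * (norm e / \<kappa>)"
          using \<kappa>(2)[OF w(1)] \<kappa>(1) N by (intro mult_left_mono) (auto simp: e_def field_simps)
        finally have "norm p \<le> L * norm e" by (simp add: L_def algebra_simps)
        then have "N * norm p \<le> N * (L * norm e)" using N by (intro mult_left_mono) auto
        then show ?thesis using n L by (simp add: field_simps)
      qed
      then show ?thesis using N L by (intro exI[of _ "N / L"]) auto
    qed
    obtain c1 where c1: "c1 > 0" "\<And>p. c1 * norm p \<le> norm (R p - N *\<^sub>R p)" using near[of 1] by auto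
    obtain c2 where c2: "c2 > 0" "\<And>p. c2 * norm p \<le> norm (R p + N *\<^sub>R p)" using near[of "-1"] by auto
    show False
    proof (rule norm_attained_in_approximate_spectrum[OF bl sym])
      show "onorm R > 0" using N by (simp add: N_def)
      show "min c1 c2 > 0" using c1 c2 by simp
      show "min c1 c2 * norm p \<le> norm (R p - onorm R *\<^sub>R p)" for p
        using c1(2)[of p] unfolding N_def[symmetric]
        by (rule order_trans[rotated]) (simp add: mult_right_mono)
      show "min c1 c2 * norm p \<le> norm (R p + onorm R *\<^sub>R p)" for p
        using c2(2)[of p] unfolding N_def[symmetric]
        by (rule order_trans[rotated]) (simp add: mult_right_mono)
    qed
  qed
  have "norm u \<le> N * norm (T u)" using onorm[OF bl, of "T u"] RT[OF u] by (simp add: N_def)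
  also have "\<dots> \<le> 1 / r * norm (T u)" using \<open>N \<le> 1 / r\<close> by (intro mult_right_mono) auto
  finally have "r * norm u \<le> norm (T u)" using r by (simp add: field_simps)
  then show ?thesis by (simp add: T_def m_def r_def)
qed

section \<open>Lower bounds for \<open>A + \<i>B\<close>\<close>

text \<open>With \<open>P = A - x\<close> and \<open>Q = B - y\<close>, the bound for
  \<open>P + \<i>Q\<close> gives injectivity and closed range, the one for \<open>P - \<i>Q\<close>
  the trivial kernel of the adjoint. Having both signs also allows \<open>A\<close> and
  \<open>B\<close> to be exchanged.\<close>

definition separated :: "'a::complex_hilbert_space set \<Rightarrow> ('a \<Rightarrow> 'a) \<Rightarrow> ('a \<Rightarrow> 'a) \<Rightarrow> real \<Rightarrow> real \<Rightarrow> bool"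
  where "separated D A B x y \<longleftrightarrow> (\<exists>\<kappa>>0. \<forall>u\<in>D.
    \<kappa> * norm u \<le> norm ((A u - x *\<^sub>R u) + \<i> *\<^sub>C (B u - y *\<^sub>R u)) \<and>
    \<kappa> * norm u \<le> norm ((A u - x *\<^sub>R u) - \<i> *\<^sub>C (B u - y *\<^sub>R u)))"

text \<open>Multiplication by \<i> is isometric and carries \<open>p - \<i>q\<close> to
  \<open>q + \<i>p\<close>, and \<open>p + \<i>q\<close> to the negative of
  \<open>q - \<i>p\<close>.\<close>

lemma separated_swap:
  fixes A B :: "'a::complex_hilbert_space \<Rightarrow> 'a"
  assumes "separated D A B x y"
  shows "separated D B A y x"
proof -
  have eq: "norm (q + \<i> *\<^sub>C p) = norm (p - \<i> *\<^sub>C q)" "norm (q - \<i> *\<^sub>C p) = norm (p + \<i> *\<^sub>C q)" for p q :: 'a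
  proof -
    show "norm (q + \<i> *\<^sub>C p) = norm (p - \<i> *\<^sub>C q)"
      using norm_imaginary[of "p - \<i> *\<^sub>C q"]
      by (simp add: complex_vector.scale_right_diff_distrib imaginary_imaginary add.commute)
    show "norm (q - \<i> *\<^sub>C p) = norm (p + \<i> *\<^sub>C q)"
      using norm_imaginary[of "p + \<i> *\<^sub>C q"]
      by (simp add: scaleC_add_right imaginary_imaginary norm_minus_commute)
  qed
  show ?thesis
    using assms unfolding separated_def eq[of "B u - y *\<^sub>R u" "A u - x *\<^sub>R u" for u] by blast
qed

text \<open>\<open>S\<close> collects the bounded terms and \<open>S'\<close> is its adjoint; the
  two bounds in \<open>separated\<close> supply the lower bound and the kernel condition of
  \<open>self_adjoint_perturbation_bijective\<close>.\<close>

lemma separated_in_resolvent_set: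
  assumes sa: "self_adjoint D A" and sb: "self_adjoint UNIV B" and bd: "bounded_operator UNIV B"
    and sep: "separated D A B (Re z) (Im z)"
  shows "z \<in> resolvent_set D (\<lambda>x. A x + \<i> *\<^sub>C B x)"
proof -
  note bl = self_adjoint_bounded_linear[OF sb bd]
  define S where "S u = \<i> *\<^sub>C B u - z *\<^sub>C u" for u
  define S' where "S' u = - (\<i> *\<^sub>C B u) - cnj z *\<^sub>C u" for u
  have pq: "A u + S u = (A u - Re z *\<^sub>R u) + \<i> *\<^sub>C (B u - Im z *\<^sub>R u)"
    "A u + S' u = (A u - Re z *\<^sub>R u) - \<i> *\<^sub>C (B u - Im z *\<^sub>R u)" for u
    by (simp_all add: S_def S'_def scaleC_complex_decompose[of z] scaleC_complex_decompose[of "cnj z"]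
        complex_vector.scale_right_diff_distrib scaleC_scaleR_commute)
  obtain \<kappa> where \<kappa>: "\<kappa> > 0" "\<And>u. u \<in> D \<Longrightarrow> \<kappa> * norm u \<le> norm (A u + S u)"
      "\<And>u. u \<in> D \<Longrightarrow> \<kappa> * norm u \<le> norm (A u + S' u)"
    using sep unfolding separated_def pq by blast
  have "bounded_linear (\<lambda>u. \<i> *\<^sub>C B u - (Re z *\<^sub>R u + Im z *\<^sub>R (\<i> *\<^sub>C u)))"
    by (rule bounded_linear_sub[OF bounded_linear_compose[OF bounded_linear_imaginary bl]
          bounded_linear_add[OF bounded_linear_scaleR_right
            bounded_linear_compose[OF bounded_linear_scaleR_right bounded_linear_imaginary]]])
  then have S: "bounded_linear S" by (simp add: S_def[abs_def] scaleC_complex_decompose[of z])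
  have adj: "inner (S u) v = inner u (S' v)" for u v
    by (simp add: S_def S'_def inner_diff_left inner_diff_right inner_imaginary_left
        inner_scaleC_left[of z] self_adjoint_inner[OF sb] self_adjoint_scaleC[OF sb])
  have ker: "u = 0" if "u \<in> D" "A u + S' u = 0" for u
    using \<kappa>(3)[OF that(1)] that(2) \<kappa>(1) by (simp add: mult_le_0_iff)
  have eq: "(\<lambda>u. A u + \<i> *\<^sub>C B u - z *\<^sub>C u) = (\<lambda>u. A u + S u)" by (simp add: S_def fun_eq_iff)
  show ?thesis
    unfolding resolvent_set_def mem_Collect_eq eq
    by (intro conjI self_adjoint_perturbation_bijective[OF sa S adj \<kappa>(1,2) ker])
qed

text \<open>The hypotheses say that the complex products of \<open>p\<close> and \<open>q\<close>
  with \<open>u\<close> are real. Pairing \<open>p + \<i>q\<close> with \<open>u\<close> and with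
  \<open>\<i>u\<close> therefore isolates one of them each time, and Cauchy-Schwarz applies.\<close>

lemma inner_le_norm_add_imaginary:
  fixes p q u :: "'a::complex_hilbert_space"
  assumes "inner p (\<i> *\<^sub>C u) = 0" and "inner q (\<i> *\<^sub>C u) = 0"
  shows "\<bar>inner p u\<bar> \<le> norm (p + \<i> *\<^sub>C q) * norm u" and "\<bar>inner q u\<bar> \<le> norm (p + \<i> *\<^sub>C q) * norm u"
proof -
  have "inner (p + \<i> *\<^sub>C q) u = inner p u"
    using assms by (simp add: inner_add_left inner_imaginary_left)
  then show "\<bar>inner p u\<bar> \<le> norm (p + \<i> *\<^sub>C q) * norm u"
    using Cauchy_Schwarz_ineq2[of "p + \<i> *\<^sub>C q" u] by simp
  have "inner (p + \<i> *\<^sub>C q) (\<i> *\<^sub>C u) = inner q u"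
    using assms by (simp add: inner_add_left inner_imaginary_left imaginary_imaginary)
  then show "\<bar>inner q u\<bar> \<le> norm (p + \<i> *\<^sub>C q) * norm u"
    using Cauchy_Schwarz_ineq2[of "p + \<i> *\<^sub>C q" "\<i> *\<^sub>C u"] by (simp add: norm_imaginary)
qed

text \<open>Quantitative form of the kernel argument: the norm of \<open>p + \<i>q\<close> bounds
  the defect in \<open>norm p = norm q\<close> and in the orthogonality of \<open>p\<close> and
  \<open>q\<close> to \<open>u\<close>. \<xi> and \<eta> are the offsets from the two
  midpoints.\<close>

lemma norm_add_imaginary_estimate:
  fixes p q u :: "'a::complex_hilbert_space"
  assumes "inner p (\<i> *\<^sub>C u) = 0" and "inner q (\<i> *\<^sub>C u) = 0"
    and p: "r * norm u \<le> norm (p + \<xi> *\<^sub>R u)" and r: "r \<ge> 0"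
    and q: "norm (q + \<eta> *\<^sub>R u) \<le> s * norm u"
  shows "((r\<^sup>2 - \<xi>\<^sup>2) - (s\<^sup>2 - \<eta>\<^sup>2)) * (norm u)\<^sup>2 \<le>
    (2 * \<bar>\<xi>\<bar> + 2 * \<bar>\<eta>\<bar> + 2 * (s + \<bar>\<eta>\<bar>)) * (norm (p + \<i> *\<^sub>C q) * norm u) + (norm (p + \<i> *\<^sub>C q))\<^sup>2"
proof -
  define E where "E = norm (p + \<i> *\<^sub>C q)"
  have E: "E \<ge> 0" by (simp add: E_def)
  have pu: "\<bar>inner p u\<bar> \<le> E * norm u" and qu: "\<bar>inner q u\<bar> \<le> E * norm u"
    unfolding E_def by (rule inner_le_norm_add_imaginary assms(1,2))+
  have sq: "(norm (w + t *\<^sub>R u))\<^sup>2 = (norm w)\<^sup>2 + 2 * (t * inner w u) + t\<^sup>2 * (norm u)\<^sup>2" for w t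
    unfolding power2_norm_eq_inner by (simp add: inner_simps inner_commute power2_eq_square)
  have tw: "\<bar>t * inner w u\<bar> \<le> \<bar>t\<bar> * (E * norm u)" if "\<bar>inner w u\<bar> \<le> E * norm u" for t w
    unfolding abs_mult using that by (intro mult_left_mono) auto
  have "(r * norm u)\<^sup>2 \<le> (norm (p + \<xi> *\<^sub>R u))\<^sup>2" using p r by (intro power_mono) auto
  then have 1: "(r\<^sup>2 - \<xi>\<^sup>2) * (norm u)\<^sup>2 \<le> (norm p)\<^sup>2 + 2 * (\<bar>\<xi>\<bar> * (E * norm u))"
    using tw[OF pu, of \<xi>] unfolding sq by (simp add: power_mult_distrib left_diff_distrib)
  have "(norm (q + \<eta> *\<^sub>R u))\<^sup>2 \<le> (s * norm u)\<^sup>2" using q by (intro power_mono) auto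
  then have 2: "(norm q)\<^sup>2 \<le> (s\<^sup>2 - \<eta>\<^sup>2) * (norm u)\<^sup>2 + 2 * (\<bar>\<eta>\<bar> * (E * norm u))"
    using tw[OF qu, of \<eta>] unfolding sq by (simp add: power_mult_distrib left_diff_distrib)
  \<comment> \<open>Bounding \<open>q\<close> by a multiple of \<open>u\<close> turns the cross term
    \<open>norm q * E\<close> into a multiple of \<open>E * norm u\<close>.\<close>
  have "norm q \<le> norm (q + \<eta> *\<^sub>R u) + \<bar>\<eta>\<bar> * norm u"
    using norm_triangle_ineq4[of "q + \<eta> *\<^sub>R u" "\<eta> *\<^sub>R u"] by simp
  then have "norm q \<le> (s + \<bar>\<eta>\<bar>) * norm u" using q by (simp add: distrib_right)
  then have 3: "norm q * E \<le> (s + \<bar>\<eta>\<bar>) * norm u * E" using E by (rule mult_right_mono)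
  have "norm p \<le> E + norm q"
    using norm_triangle_ineq4[of "p + \<i> *\<^sub>C q" "\<i> *\<^sub>C q"] by (simp add: E_def norm_imaginary)
  then have "(norm p)\<^sup>2 \<le> (E + norm q)\<^sup>2" by (rule power_mono) simp
  then have "(norm p)\<^sup>2 \<le> E\<^sup>2 + 2 * (norm q * E) + (norm q)\<^sup>2"
    by (simp add: power2_eq_square algebra_simps)
  with 1 2 3 show ?thesis unfolding E_def[symmetric] by (simp add: algebra_simps)
qed

lemma quadratic_estimate_lower_bound:
  fixes g C :: real
  assumes g: "g > 0" and C: "C \<ge> 0"
  obtains \<kappa> where "\<kappa> > 0"
    and "\<And>U E. 0 \<le> U \<Longrightarrow> 0 \<le> E \<Longrightarrow> g * U\<^sup>2 \<le> C * (E * U) + E\<^sup>2 \<Longrightarrow> \<kappa> * U \<le> E"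
proof -
  \<comment> \<open>The bound 1 gives \<open>\<kappa>^2 \<le> \<kappa>\<close>; the other gives
    \<open>\<kappa> (C + 1) \<le> g\<close>. If \<open>E < \<kappa> U\<close>, the right-hand side
    would then drop below \<open>g U^2\<close>.\<close>
  define \<kappa> where "\<kappa> = min 1 (g / (C + 1))"
  have \<kappa>: "\<kappa> > 0" "\<kappa> \<le> 1" using g C by (auto simp: \<kappa>_def)
  have "\<kappa> \<le> g / (C + 1)" by (simp add: \<kappa>_def)
  then have \<kappa>g: "\<kappa> * (C + 1) \<le> g" using C by (simp add: field_simps)
  have "\<kappa> * U \<le> E" if U: "0 \<le> U" and E: "0 \<le> E" and le: "g * U\<^sup>2 \<le> C * (E * U) + E\<^sup>2" for U E
  proof (rule ccontr)
    assume "\<not> \<kappa> * U \<le> E"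
    then have lt: "E < \<kappa> * U" by simp
    have "E * U \<le> \<kappa> * U * U" using lt U by (intro mult_right_mono) auto
    then have "C * (E * U) \<le> C * (\<kappa> * U\<^sup>2)" using C by (intro mult_left_mono) (auto simp: power2_eq_square)
    moreover have "E\<^sup>2 < (\<kappa> * U)\<^sup>2" using lt E by (intro power_strict_mono) auto
    moreover have "(\<kappa> * U)\<^sup>2 \<le> \<kappa> * U\<^sup>2"
      unfolding power_mult_distrib using \<kappa>
      by (intro mult_right_mono) (simp_all add: power2_eq_square mult_left_le)
    moreover have "\<kappa> * (C + 1) * U\<^sup>2 \<le> g * U\<^sup>2" using \<kappa>g by (intro mult_right_mono) auto
    ultimately show False using le by (simp add: algebra_simps)
  qed
  then show thesis using that \<kappa>(1) by blast
qed

text \<open>The strict inequality leaves a margin \<open>g\<close> in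
  \<open>norm_add_imaginary_estimate\<close>, which \<open>quadratic_estimate_lower_bound\<close>
  converts into a \<kappa> independent of \<open>u\<close>.\<close>

lemma separated_of_norm_bounds:
  assumes orth: "\<And>u. u \<in> D \<Longrightarrow> inner (A u) (\<i> *\<^sub>C u) = 0" "\<And>u. u \<in> D \<Longrightarrow> inner (B u) (\<i> *\<^sub>C u) = 0"
    and A: "\<And>u. u \<in> D \<Longrightarrow> r * norm u \<le> norm (A u - m *\<^sub>R u)" and r: "r \<ge> 0"
    and B: "\<And>u. u \<in> D \<Longrightarrow> norm (B u - n *\<^sub>R u) \<le> s * norm u" and s: "s \<ge> 0"
    and lt: "s\<^sup>2 - (y - n)\<^sup>2 < r\<^sup>2 - (x - m)\<^sup>2"
  shows "separated D A B x y"
proof -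
  define g where "g = (r\<^sup>2 - (x - m)\<^sup>2) - (s\<^sup>2 - (y - n)\<^sup>2)"
  define C where "C = 2 * \<bar>x - m\<bar> + 2 * \<bar>y - n\<bar> + 2 * (s + \<bar>y - n\<bar>)"
  obtain \<kappa> where \<kappa>: "\<kappa> > 0"
    "\<And>U E. 0 \<le> U \<Longrightarrow> 0 \<le> E \<Longrightarrow> g * U\<^sup>2 \<le> C * (E * U) + E\<^sup>2 \<Longrightarrow> \<kappa> * U \<le> E"
    by (rule quadratic_estimate_lower_bound[of g C]) (use lt s in \<open>auto simp: g_def C_def\<close>)
  have "\<kappa> * norm u \<le> norm ((A u - x *\<^sub>R u) + \<i> *\<^sub>C (B u - y *\<^sub>R u)) \<and>
    \<kappa> * norm u \<le> norm ((A u - x *\<^sub>R u) - \<i> *\<^sub>C (B u - y *\<^sub>R u))" if u: "u \<in> D" for u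
  proof -
    let ?p = "A u - x *\<^sub>R u" and ?q = "B u - y *\<^sub>R u"
    have p0: "inner ?p (\<i> *\<^sub>C u) = 0" and q0: "inner ?q (\<i> *\<^sub>C u) = 0"
      using orth[OF u] by (simp_all add: inner_diff_left inner_imaginary_self)
    have p: "r * norm u \<le> norm (?p + (x - m) *\<^sub>R u)" using A[OF u] by (simp add: scaleR_diff_left)
    have q: "norm (?q + (y - n) *\<^sub>R u) \<le> s * norm u" using B[OF u] by (simp add: scaleR_diff_left)
    \<comment> \<open>The opposite sign is the same estimate for \<open>- ?q\<close> with the offset
      negated; \<open>g\<close> and \<open>C\<close> are unchanged, as they contain only its square
      and absolute value.\<close>
    have "- ?q + (- (y - n)) *\<^sub>R u = - (?q + (y - n) *\<^sub>R u)" by (simp add: scaleR_diff_left)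
    then have q': "norm (- ?q + (- (y - n)) *\<^sub>R u) \<le> s * norm u" using q by (metis norm_minus_cancel)
    have q0': "inner (- ?q) (\<i> *\<^sub>C u) = 0" unfolding inner_minus_left q0 by simp
    have "\<kappa> * norm u \<le> norm (?p + \<i> *\<^sub>C ?q)"
      using norm_add_imaginary_estimate[OF p0 q0 p r q] by (intro \<kappa>(2)) (auto simp: g_def C_def)
    moreover have "\<kappa> * norm u \<le> norm (?p + \<i> *\<^sub>C (- ?q))"
      using norm_add_imaginary_estimate[OF p0 q0' p r q']
      by (intro \<kappa>(2)) (simp_all only: g_def C_def abs_minus_cancel power2_minus norm_ge_zero)
    ultimately show ?thesis by (simp only: complex_vector.scale_minus_right add_uminus_conv_diff)
  qed
  then show ?thesis unfolding separated_def using \<kappa>(1) by blast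
qed

text \<open>Handles points whose real part is away from the numerical range of \<open>A\<close> and,
  after a swap, those whose imaginary part is outside the spectral interval of
  \<open>B\<close>.\<close>

lemma separated_of_form_bound:
  assumes orth: "\<And>u. u \<in> D \<Longrightarrow> inner (A u) (\<i> *\<^sub>C u) = 0" "\<And>u. u \<in> D \<Longrightarrow> inner (B u) (\<i> *\<^sub>C u) = 0"
    and e: "e > 0" and A: "\<And>u. u \<in> D \<Longrightarrow> e * (norm u)\<^sup>2 \<le> \<bar>inner (A u - x *\<^sub>R u) u\<bar>"
  shows "separated D A B x y"
proof -
  have *: "e * norm u \<le> norm ((A u - x *\<^sub>R u) + \<i> *\<^sub>C q)"
    if u: "u \<in> D" and q: "inner q (\<i> *\<^sub>C u) = 0" for u q
  proof (cases "u = 0")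
    case False
    have p0: "inner (A u - x *\<^sub>R u) (\<i> *\<^sub>C u) = 0"
      using orth(1)[OF u] by (simp add: inner_diff_left inner_imaginary_self)
    have "e * norm u * norm u \<le> norm ((A u - x *\<^sub>R u) + \<i> *\<^sub>C q) * norm u"
      using A[OF u] inner_le_norm_add_imaginary(1)[OF p0 q] by (simp add: power2_eq_square)
    then show ?thesis using False by simp
  qed simp
  have q: "inner (B u - y *\<^sub>R u) (\<i> *\<^sub>C u) = 0" "inner (- (B u - y *\<^sub>R u)) (\<i> *\<^sub>C u) = 0" if "u \<in> D" for u
    using orth(2)[OF that] unfolding inner_minus_left
    by (simp_all add: inner_diff_left inner_imaginary_self)
  have "e * norm u \<le> norm ((A u - x *\<^sub>R u) - \<i> *\<^sub>C (B u - y *\<^sub>R u))" if "u \<in> D" for u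
    using *[OF that q(2)[OF that]]
    by (simp only: complex_vector.scale_minus_right add_uminus_conv_diff)
  then show ?thesis unfolding separated_def using e * q(1) by blast
qed

section \<open>From the regions to the enclosures\<close>

text \<open>Since \<open>(x - a)(x - b)\<close> is the squared distance of \<open>x\<close> to the
  midpoint minus the squared half-length, both shapes of the region lead to the same
  inequality.\<close>

lemma region_U_D:
  assumes "z \<in> region_U a b c d"
  shows "((d - c) / 2)\<^sup>2 - (Im z - (c + d) / 2)\<^sup>2 < ((b - a) / 2)\<^sup>2 - (Re z - (a + b) / 2)\<^sup>2"
proof (cases "b - a \<le> d - c")
  case True
  let ?X = "((d - c) / 2)\<^sup>2 + (Re z - a) * (Re z - b)"
  \<comment> \<open>The absolute value merges the parts below \<open>h_minus\<close> and above
    \<open>h_plus\<close>.\<close>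
  have "sqrt ?X < \<bar>Im z - (c + d) / 2\<bar>"
    using assms True by (auto simp: region_U_def h_minus_def h_plus_def)
  then have "?X < (Im z - (c + d) / 2)\<^sup>2"
    by (simp only: real_sqrt_less_iff flip: real_sqrt_abs)
  then show ?thesis by (simp add: power2_eq_square field_simps)
next
  case False
  let ?X = "((b - a) / 2)\<^sup>2 + (Im z - c) * (Im z - d)"
  have "\<bar>Re z - (a + b) / 2\<bar> < sqrt ?X"
    using assms False by (auto simp: region_U_def k_minus_def k_plus_def)
  then have "(Re z - (a + b) / 2)\<^sup>2 < ?X"
    by (simp only: real_sqrt_less_iff flip: real_sqrt_abs)
  then show ?thesis by (simp add: power2_eq_square field_simps)
qed

text \<open>Each way of leaving the region forces separation: a form bound outside the closed
  numerical range or the strip, norm bounds inside a gap region. Phrased with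
  \<open>separated\<close>, it can be reused with \<open>A\<close> and \<open>B\<close>
  exchanged.\<close>

lemma not_separated_in_region_X:
  assumes sa: "self_adjoint D A" and sb: "self_adjoint UNIV B" and bd: "bounded_operator UNIV B"
    and lt: "min_spectrum UNIV B < max_spectrum UNIV B"
    and nsep: "\<not> separated D A B (Re z) (Im z)"
  shows "z \<in> region_X D A (min_spectrum UNIV B) (max_spectrum UNIV B)"
proof -
  define c d where "c = min_spectrum UNIV B" and "d = max_spectrum UNIV B"
  \<comment> \<open>On a zero domain any constant separates, so a nonzero vector is available for
    the spectral bounds of \<open>B\<close>.\<close>
  have "\<exists>v\<in>D. v \<noteq> 0"
  proof (rule ccontr)
    assume "\<not> (\<exists>v\<in>D. v \<noteq> 0)"
    then have "separated D A B (Re z) (Im z)" unfolding separated_def by (intro exI[of _ 1]) auto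
    with nsep show False by simp
  qed
  then obtain v :: 'a where v: "v \<noteq> 0" by blast
  have lo: "c * (norm u)\<^sup>2 \<le> inner (B u) u" and hi: "inner (B u) u \<le> d * (norm u)\<^sup>2" for u
    unfolding c_def d_def by (rule quadratic_form_spectrum_bounds[OF sb bd v])+
  note oA = self_adjoint_inner_imaginary[OF sa]
  note oB = self_adjoint_inner_imaginary[OF sb UNIV_I]
  have "complex_of_real (Re z) \<in> closure (numerical_range D A)"
  proof (rule ccontr)
    assume "complex_of_real (Re z) \<notin> closure (numerical_range D A)"
    then obtain e where e: "e > 0"
        "\<And>w. w \<in> numerical_range D A \<Longrightarrow> e \<le> dist w (complex_of_real (Re z))"
      unfolding closure_approachable by (meson not_le)
    have "e * (norm u)\<^sup>2 \<le> \<bar>inner (A u - Re z *\<^sub>R u) u\<bar>" if u: "u \<in> D" for u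
    proof (cases "u = 0")
      case False
      have su: "sgn u \<in> D" unfolding sgn_div_norm using self_adjoint_mem_scaleR[OF sa u] .
      have "complex_of_real (inner (A (sgn u)) (sgn u)) \<in> numerical_range D A"
        using su False self_adjoint_cinner_self[OF sa su]
        by (auto simp: numerical_range_def norm_sgn intro!: exI[of _ "sgn u"])
      then have "e \<le> \<bar>inner (A (sgn u)) (sgn u) - Re z\<bar>"
        using e(2) by (fastforce simp: dist_of_real dist_real_def)
      also have "inner (A (sgn u)) (sgn u) = inner (A u) u / (norm u)\<^sup>2"
        by (simp add: sgn_div_norm self_adjoint_scaleR[OF sa u] power2_eq_square field_simps)
      also have "inner (A u) u / (norm u)\<^sup>2 - Re z = inner (A u - Re z *\<^sub>R u) u / (norm u)\<^sup>2"
        using False by (simp add: inner_diff_left diff_divide_distrib power2_norm_eq_inner)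
      finally show ?thesis using False by (simp add: field_simps)
    qed simp
    then show False using separated_of_form_bound[OF oA oB e(1)] nsep by blast
  qed
  moreover have "c \<le> Im z \<and> Im z \<le> d"
  proof (rule ccontr)
    assume "\<not> (c \<le> Im z \<and> Im z \<le> d)"
    then have e: "max (c - Im z) (Im z - d) > 0" by auto
    have "max (c - Im z) (Im z - d) * (norm u)\<^sup>2 \<le> \<bar>inner (B u - Im z *\<^sub>R u) u\<bar>" for u
    proof -
      have "inner (B u - Im z *\<^sub>R u) u = inner (B u) u - Im z * (norm u)\<^sup>2"
        by (simp add: inner_diff_left power2_norm_eq_inner)
      then show ?thesis using lo[of u] hi[of u] by (auto simp: max_def left_diff_distrib)
    qed
    then have "separated D B A (Im z) (Re z)" using separated_of_form_bound[OF oB oA e] by blast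
    then show False using separated_swap nsep by blast
  qed
  moreover have "z \<notin> union_U D A c d"
  proof
    assume "z \<in> union_U D A c d"
    then obtain a b where z: "z \<in> region_U a b c d" and ab: "a < b"
      and gap: "complex_of_real ` {a<..<b} \<subseteq> resolvent_set D A" by (auto simp: union_U_def)
    have cd: "c < d" using lt by (simp add: c_def d_def)
    have B: "norm (B u - ((c + d) / 2) *\<^sub>R u) \<le> (d - c) / 2 * norm u" for u
      by (rule norm_center_le[OF bounded_linear.linear[OF self_adjoint_bounded_linear[OF sb bd]]
            self_adjoint_inner[OF sb UNIV_I UNIV_I] lo hi cd])
    have "separated D A B (Re z) (Im z)"
    proof (rule separated_of_norm_bounds)
      show "inner (A u) (\<i> *\<^sub>C u) = 0" if "u \<in> D" for u using oA[OF that] .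
      show "inner (B u) (\<i> *\<^sub>C u) = 0" for u by (rule oB)
      show "(b - a) / 2 * norm u \<le> norm (A u - ((a + b) / 2) *\<^sub>R u)" if "u \<in> D" for u
        by (rule resolvent_gap_lower_bound[OF sa ab gap that])
      show "norm (B u - ((c + d) / 2) *\<^sub>R u) \<le> (d - c) / 2 * norm u" for u by (rule B)
    qed (use ab cd region_U_D[OF z] in simp_all)
    with nsep show False ..
  qed
  ultimately show ?thesis by (simp add: region_X_def c_def d_def)
qed

theorem theorem3p6:
  fixes D :: "'a::complex_hilbert_space set" and A B :: "'a \<Rightarrow> 'a"
    and bmin bmax amin amax :: real
  assumes "self_adjoint D A"
    and "self_adjoint UNIV B" and "bounded_operator UNIV B"
    and "bmin = min_spectrum UNIV B" and "bmax = max_spectrum UNIV B" and "bmin < bmax"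
  shows "(\<not> bounded_from_above D A \<or> \<not> bounded_from_below D A \<longrightarrow>
            spectrum D (\<lambda>x. A x + \<i> *\<^sub>C B x) \<subseteq> region_X D A bmin bmax) \<and>
         (bounded_operator D A \<and> amin = min_spectrum D A \<and> amax = max_spectrum D A \<and> amin < amax \<longrightarrow>
            spectrum D (\<lambda>x. A x + \<i> *\<^sub>C B x) \<subseteq>
              region_X D A bmin bmax \<inter> region_Y UNIV B amin amax)"
proof -
  have nsep: "\<not> separated D A B (Re z) (Im z)" if "z \<in> spectrum D (\<lambda>x. A x + \<i> *\<^sub>C B x)" for z
    using that separated_in_resolvent_set[OF assms(1-3)] by (auto simp: spectrum_def)
  then have X: "spectrum D (\<lambda>x. A x + \<i> *\<^sub>C B x) \<subseteq> region_X D A bmin bmax"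
    using not_separated_in_region_X[OF assms(1-3)] assms(4-6) by blast
  moreover have "z \<in> region_Y UNIV B amin amax"
    if A: "bounded_operator D A" "amin = min_spectrum D A" "amax = max_spectrum D A" "amin < amax"
      and z: "z \<in> spectrum D (\<lambda>x. A x + \<i> *\<^sub>C B x)" for z
  proof -
    have D: "D = UNIV" using self_adjoint_bounded_domain[OF assms(1) A(1)] .
    \<comment> \<open>Reflecting \<open>z\<close> in the diagonal matches the exchange of
      \<open>A\<close> and \<open>B\<close>, and is the reflection built into
      \<open>region_V\<close>.\<close>
    let ?w = "complex_of_real (Im z) + \<i> * complex_of_real (Re z)"
    have "\<not> separated UNIV B A (Re ?w) (Im ?w)"
      using nsep[OF z] separated_swap[of UNIV B A "Im z" "Re z"] by (auto simp: D)
    then have "?w \<in> region_X UNIV B amin amax"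
      using not_separated_in_region_X[OF assms(2), of A ?w] assms(1) A by (simp add: D)
    then show ?thesis by (simp add: region_X_def region_Y_def region_V_def)
  qed
  ultimately show ?thesis by blast
qed

end
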